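(* Let $X_1,X_2,\dots$ be iid with parent random variable $X$ having finite mean $\mu$ and variance $\sigma^2$; fix $p\in(0,1)$ and an integer $r\ge1$. Assume $F_X$ is differentiable at $q_X(p)$ with $f_X(q_X(p))>0$, $\mathbb{E}[X^{2r}]<\infty$, and, if $r=1$, that the density $f_X$ exists and is positive at $\mu$ (so $F_X$ is continuous at $\mu$). Let $h_1,h_2$ be continuous real functions differentiable at $q_X(p)$ and $m(X,r)$. Write $c_r=\mathbb{E}\big[(X-\mu)^{r-1}(\operatorname{sgn}(X-\mu))^r\big]$. Then $$\sqrt n\begin{pmatrix} h_1(q_n(p))-h_1(q_X(p))\\ h_2(\hat m(X,n,r))-h_2(m(X,r))\end{pmatrix}\xrightarrow{d}\mathcal N(0,\Sigma^{(r)}),$$ with $\Sigma^{(r)}_{11}=\frac{p(1-p)}{f_X^2(q_X(p))}(h_1'(q_X(p)))^2$, $\Sigma^{(r)}_{22}=(h_2'(m(X,r)))^2\operatorname{Var}\big(|X-\mu|^r-r c_r(X-\mu)\big)$, and $$\Sigma^{(r)}_{12}=\Sigma^{(r)}_{21}=h_1'(q_X(p))h_2'(m(X,r))\frac{\tau_r(|X-\mu|,p)-r c_r\,\tau_1(p)}{f_X(q_X(p))}.$$ Consequently, if $h_1'(q_X(p))h_2'(m(X,r))\ne0$ and $\operatorname{Var}(|X-\mu|^r-rc_r(X-\mu))>0$, the correlation of the limiting law equals $$\operatorname{sgn}\!\big(h_1'(q_X(p))h_2'(m(X,r))\big)\frac{\tau_r(|X-\mu|,p)-rc_r\tau_1(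p)}{\sqrt{p(1-p)\operatorname{Var}\big(|X-\mu|^r-rc_r(X-\mu)\big)}}.$$
   Context: $F_X,f_X$ cdf and density of $X$; $q_X(p)=\inf\{x:F_X(x)\ge p\}$; $q_n(p)=X_{(\lceil np\rceil)}$; $\bar X_n=\frac1n\sum X_i$; $m(X,r)=\mathbb{E}|X-\mu|^r$; $\hat m(X,n,r)=\frac1n\sum_{i=1}^n|X_i-\bar X_n|^r$. For continuous $\eta$, $\tau_k(\eta(X),p):=(1-p)\big(\mathbb{E}[\eta^k(X)\mid X>q_X(p)]-\mathbb{E}[\eta^k(X)]\big)$ and $\tau_k(p):=\tau_k(X,p)$; $\operatorname{sgn}$ is the signum function. *)

theory Defs
  imports "HOL-Probability.Probability"
begin

definition cdf_rv :: "'a measure \<Rightarrow> ('a \<Rightarrow> real) \<Rightarrow> real \<Rightarrow> real" where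
  "cdf_rv M X x = measure M {\<omega> \<in> space M. X \<omega> \<le> x}"

definition quantile_rv :: "'a measure \<Rightarrow> ('a \<Rightarrow> real) \<Rightarrow> real \<Rightarrow> real" where
  "quantile_rv M X p = Inf {x. cdf_rv M X x \<ge> p}"

definition order_stat :: "real list \<Rightarrow> nat \<Rightarrow> real" where
  "order_stat xs k = sort xs ! (k - 1)"

text \<open>Sample quantile q_n(p) = X_(ceil(n p)) from X_1..X_n (here indexed Xs 0 .. Xs (n-1)).\<close>
definition sample_quantile :: "(nat \<Rightarrow> 'a \<Rightarrow> real) \<Rightarrow> nat \<Rightarrow> real \<Rightarrow> 'a \<Rightarrow> real" where
  "sample_quantile Xs n p \<omega> = order_stat (map (\<lambda>i. Xs i \<omega>) [0..<n]) (nat \<lceil>real n * p\<rceil>)"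

definition sample_mean :: "(nat \<Rightarrow> 'a \<Rightarrow> real) \<Rightarrow> nat \<Rightarrow> 'a \<Rightarrow> real" where
  "sample_mean Xs n \<omega> = (\<Sum>i<n. Xs i \<omega>) / real n"

definition abs_central_moment :: "'a measure \<Rightarrow> ('a \<Rightarrow> real) \<Rightarrow> nat \<Rightarrow> real" where
  "abs_central_moment M X r = (\<integral>\<omega>. \<bar>X \<omega> - (\<integral>\<omega>'. X \<omega>' \<partial>M)\<bar> ^ r \<partial>M)"

definition sample_abs_central_moment :: "(nat \<Rightarrow> 'a \<Rightarrow> real) \<Rightarrow> nat \<Rightarrow> nat \<Rightarrow> 'a \<Rightarrow> real" where
  "sample_abs_central_moment Xs n r \<omega> =
     (\<Sum>i<n. \<bar>Xs i \<omega> - sample_mean Xs n \<omega>\<bar> ^ r) / real n"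

definition cond_exp_event :: "'a measure \<Rightarrow> ('a \<Rightarrow> real) \<Rightarrow> 'a set \<Rightarrow> real" where
  "cond_exp_event M Y A = (\<integral>\<omega>. indicator A \<omega> * Y \<omega> \<partial>M) / measure M A"

definition tau :: "'a measure \<Rightarrow> ('a \<Rightarrow> real) \<Rightarrow> (real \<Rightarrow> real) \<Rightarrow> nat \<Rightarrow> real \<Rightarrow> real" where
  "tau M X \<eta> k p =
     (1 - p) * (cond_exp_event M (\<lambda>\<omega>. \<eta> (X \<omega>) ^ k) {\<omega> \<in> space M. X \<omega> > quantile_rv M X p}
                - (\<integral>\<omega>. \<eta> (X \<omega>) ^ k \<partial>M))"

text \<open>Centered univariate normal law with variance v (point mass at 0 if v = 0;
  for v < 0 the null measure, which is not a probability law).\<close>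
definition centered_normal :: "real \<Rightarrow> real measure" where
  "centered_normal v =
     (if v = 0 then return borel 0
      else if v > 0 then density lborel (\<lambda>x. ennreal (normal_density 0 (sqrt v) x))
      else null_measure borel)"

text \<open>N is the (possibly degenerate) bivariate normal law N(0, Sigma) with
  Sigma = [[s11, s12], [s12, s22]]: every linear combination a x + b y is
  centered normal with variance (a,b) Sigma (a,b)^T.\<close>
definition bivariate_normal :: "(real \<times> real) measure \<Rightarrow> real \<Rightarrow> real \<Rightarrow> real \<Rightarrow> bool" where
  "bivariate_normal N s11 s12 s22 \<longleftrightarrow>
     sets N = sets (borel :: (real \<times> real) measure) \<and> prob_space N \<and>
     (\<forall>a b. distr N borel (\<lambda>(x, y). a * x + b * y) =
             centered_normal (a\<^sup>2 * s11 + 2 * a * b * s12 + b\<^sup>2 * s22))"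

definition conv_distr2 :: "'a measure \<Rightarrow> (nat \<Rightarrow> 'a \<Rightarrow> real \<times> real) \<Rightarrow> (real \<times> real) measure \<Rightarrow> bool" where
  "conv_distr2 M Y N \<longleftrightarrow>
     (\<forall>f :: real \<times> real \<Rightarrow> real. continuous_on UNIV f \<and> bounded (range f) \<longrightarrow>
        (\<lambda>n. \<integral>\<omega>. f (Y n \<omega>) \<partial>M) \<longlonglongrightarrow> (\<integral>z. f z \<partial>N))"

definition correlation2 :: "(real \<times> real) measure \<Rightarrow> real" where
  "correlation2 N =
     (let m1 = (\<integral>z. fst z \<partial>N); m2 = (\<integral>z. snd z \<partial>N) in
      (\<integral>z. (fst z - m1) * (snd z - m2) \<partial>N) /
        sqrt ((\<integral>z. (fst z - m1)\<^sup>2 \<partial>N) * (\<integral>z. (snd z - m2)\<^sup>2 \<partial>N)))"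

end

theory Submission
  imports Defs
begin

text \<open>
  Both statistics are asymptotically linear: up to terms that vanish in probability,
  \<open>\<surd>n (q\<^sub>n(p) - q)\<close> and \<open>\<surd>n (m\<^sub>n - m)\<close> are normed sums of the centred influence functions
  \<open>(p - 1{x \<le> q}) / f(q)\<close> and \<open>|x - \<mu>|\<^sup>r - m - r c (x - \<mu>)\<close>. The first claim is Ghosh's form of the
  Bahadur representation, obtained by comparing the events \<open>{\<surd>n (q\<^sub>n - q) \<le> t}\<close> with events about the
  empirical distribution function. The second follows from the convexity of \<open>|y|\<^sup>r\<close>: its subgradient
  \<open>r s(y)\<close>, \<open>s(y) = |y|\<^sup>r\<^sup>-\<^sup>1 sgn y\<close>, is monotone, so the error of linearising in the sample mean is at
  most \<open>r |d| (s(y + \<delta>) - s(y - \<delta>))\<close> for \<open>|d| \<le> \<delta>\<close>, and the mean of the increment of \<open>s\<close> tends to \<open>0\<close>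
  with \<open>\<delta>\<close>. The delta method carries this over to \<open>h1\<close> and \<open>h2\<close>, the one-dimensional central limit
  theorem gives the limit of every linear combination, and bivariate convergence follows by the
  Cramer-Wold device: trigonometric sums approximate bounded continuous functions on large boxes
  while staying bounded outside.
\<close>

section \<open>Convergence and boundedness in probability\<close>

text \<open>The distribution function is known to be differentiable only at the single point q, so
  no uniform rate for the empirical process near q is available; comparing events at the one level q
  + t / sqrt n uses just that derivative. For r = 1 the obstacle is the jump of sgn at 0: the
  increment of s has small mean only if X has no atom at \<mu>, which the density guarantees. The
  term - r c (x - \<mu>) is the price of centring at the sample mean, since moving the centre by d
  changes the mean of |X - \<mu>|^r by - r c d to first order.

  The shape of the covariance comes from p - 1{x \<le> q} = 1{x > q} - (1 - p). As the second
  influence function is centred, its covariance with the first is its mean over the tail event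
  divided by f(q), which is a difference of two values of \<open>tau\<close>.

  The covariance matrix may be singular, so its nonnegativity is read off from second moments and
  variance 0 is treated separately in the central limit theorem. The test functions are cosines with
  a phase: the phase takes over the role of the sine, and the argument stays real.\<close>

definition small_in_prob :: "'a measure \<Rightarrow> (nat \<Rightarrow> 'a \<Rightarrow> real) \<Rightarrow> bool" where
  "small_in_prob M R \<longleftrightarrow> (\<forall>n. R n \<in> borel_measurable M) \<and>
     (\<forall>e>0. (\<lambda>n. measure M {\<omega> \<in> space M. e < \<bar>R n \<omega>\<bar>}) \<longlonglongrightarrow> 0)"

text \<open>The bound is required for large n only: this is what convergence in law yields, and it
  is enough for products with small terms and for the delta method.\<close>

definition tight_in_prob :: "'a measure \<Rightarrow> (nat \<Rightarrow> 'a \<Rightarrow> real) \<Rightarrow> bool" where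
  "tight_in_prob M V \<longleftrightarrow> (\<forall>n. V n \<in> borel_measurable M) \<and>
     (\<forall>d>0. \<exists>K>0. eventually (\<lambda>n. measure M {\<omega> \<in> space M. K < \<bar>V n \<omega>\<bar>} < d) sequentially)"

lemma small_in_prob_measurable: "small_in_prob M R \<Longrightarrow> R n \<in> borel_measurable M"
  by (auto simp: small_in_prob_def)

lemma tight_in_prob_measurable: "tight_in_prob M R \<Longrightarrow> R n \<in> borel_measurable M"
  by (auto simp: tight_in_prob_def)

lemma small_in_prob_tendsto:
  "small_in_prob M R \<Longrightarrow> e > 0 \<Longrightarrow> (\<lambda>n. measure M {\<omega> \<in> space M. e < \<bar>R n \<omega>\<bar>}) \<longlonglongrightarrow> 0"
  by (auto simp: small_in_prob_def)

lemma small_in_probD: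
  assumes "small_in_prob M R" "e > 0" "d > 0"
  shows "eventually (\<lambda>n. measure M {\<omega> \<in> space M. e < \<bar>R n \<omega>\<bar>} < d) sequentially"
  using order_tendstoD(2)[OF small_in_prob_tendsto[OF assms(1,2)] assms(3)] .

context prob_space
begin

lemma small_in_probI:
  assumes "\<And>n. R n \<in> borel_measurable M"
    and "\<And>e d. e > 0 \<Longrightarrow> d > 0 \<Longrightarrow>
          eventually (\<lambda>n. prob {\<omega> \<in> space M. e < \<bar>R n \<omega>\<bar>} < d) sequentially"
  shows "small_in_prob M R"
  unfolding small_in_prob_def
proof (intro conjI allI impI)
  fix e :: real assume e: "e > 0"
  show "(\<lambda>n. prob {\<omega> \<in> space M. e < \<bar>R n \<omega>\<bar>}) \<longlonglongrightarrow> 0"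
  proof (rule order_tendstoI)
    fix a :: real assume "a < 0"
    then show "\<forall>\<^sub>F n in sequentially. a < prob {\<omega> \<in> space M. e < \<bar>R n \<omega>\<bar>}"
      by (intro always_eventually allI) (meson less_le_trans measure_nonneg)
  next
    fix a :: real assume "0 < a"
    then show "\<forall>\<^sub>F n in sequentially. prob {\<omega> \<in> space M. e < \<bar>R n \<omega>\<bar>} < a"
      using assms(2) e by blast
  qed
qed (use assms in auto)

lemma prob_less_if_subset_Un:
  assumes "A \<subseteq> B \<union> C" "B \<in> events" "C \<in> events" "prob B < d/2" "prob C < d/2"
  shows "prob A < d"
proof -
  have "prob A \<le> prob (B \<union> C)" using assms by (intro finite_measure_mono) auto
  also have "\<dots> \<le> prob B + prob C" using assms by (intro measure_Un_le) auto
  finally show ?thesis using assms by linarith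
qed

lemma small_in_prob_add:
  assumes R: "small_in_prob M R" and S: "small_in_prob M S"
  shows "small_in_prob M (\<lambda>n \<omega>. R n \<omega> + S n \<omega>)"
proof (rule small_in_probI)
  note [measurable] = small_in_prob_measurable[OF R] small_in_prob_measurable[OF S]
  show "(\<lambda>\<omega>. R n \<omega> + S n \<omega>) \<in> borel_measurable M" for n by measurable
  fix e d :: real assume e: "e > 0" "d > 0"
  have "eventually (\<lambda>n. prob {\<omega> \<in> space M. e/2 < \<bar>R n \<omega>\<bar>} < d/2) sequentially"
    "eventually (\<lambda>n. prob {\<omega> \<in> space M. e/2 < \<bar>S n \<omega>\<bar>} < d/2) sequentially"
    using e by (intro small_in_probD R S; simp)+
  then show "eventually (\<lambda>n. prob {\<omega> \<in> space M. e < \<bar>R n \<omega> + S n \<omega>\<bar>} < d) sequentially"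
    by eventually_elim
      (rule prob_less_if_subset_Un[of _ "{\<omega> \<in> space M. e/2 < \<bar>R _ \<omega>\<bar>}" "{\<omega> \<in> space M. e/2 < \<bar>S _ \<omega>\<bar>}"], auto)
qed

text \<open>Outside the two exceptional events the factors are at most K and e / K, so the product
  is at most e.\<close>

lemma small_in_prob_tight_mult:
  assumes R: "tight_in_prob M R" and S: "small_in_prob M S"
  shows "small_in_prob M (\<lambda>n \<omega>. R n \<omega> * S n \<omega>)"
proof (rule small_in_probI)
  note [measurable] = tight_in_prob_measurable[OF R] small_in_prob_measurable[OF S]
  show "(\<lambda>\<omega>. R n \<omega> * S n \<omega>) \<in> borel_measurable M" for n by measurable
  fix e d :: real assume e: "e > 0" "d > 0"
  then obtain K where K: "K > 0"
    "eventually (\<lambda>n. prob {\<omega> \<in> space M. K < \<bar>R n \<omega>\<bar>} < d/2) sequentially"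
    using R unfolding tight_in_prob_def by (meson half_gt_zero)
  have "eventually (\<lambda>n. prob {\<omega> \<in> space M. e/K < \<bar>S n \<omega>\<bar>} < d/2) sequentially"
    using e K by (intro small_in_probD S; simp)
  with K(2) show "eventually (\<lambda>n. prob {\<omega> \<in> space M. e < \<bar>R n \<omega> * S n \<omega>\<bar>} < d) sequentially"
  proof eventually_elim
    case (elim n)
    have bd: "\<not> e < \<bar>R n \<omega> * S n \<omega>\<bar>" if "\<not> K < \<bar>R n \<omega>\<bar>" "\<not> e/K < \<bar>S n \<omega>\<bar>" for \<omega>
    proof -
      have "\<bar>R n \<omega>\<bar> * \<bar>S n \<omega>\<bar> \<le> K * (e/K)"
        using that K by (intro mult_mono) auto
      then show ?thesis using K by (simp add: abs_mult)
    qed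
    have "{\<omega> \<in> space M. e < \<bar>R n \<omega> * S n \<omega>\<bar>} \<subseteq>
        {\<omega> \<in> space M. K < \<bar>R n \<omega>\<bar>} \<union> {\<omega> \<in> space M. e/K < \<bar>S n \<omega>\<bar>}"
      using bd by blast
    then show ?case
      by (rule prob_less_if_subset_Un[OF _ _ _ elim]) measurable
  qed
qed

lemma tight_in_prob_const: "tight_in_prob M (\<lambda>n \<omega>. c)"
  unfolding tight_in_prob_def
  by (auto intro!: exI[of _ "\<bar>c\<bar> + 1"])

lemma small_in_prob_cmult: "small_in_prob M S \<Longrightarrow> small_in_prob M (\<lambda>n \<omega>. c * S n \<omega>)"
  using small_in_prob_tight_mult[OF tight_in_prob_const] .

lemma tight_in_prob_add_small:
  assumes R: "tight_in_prob M R" and S: "small_in_prob M S"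
  shows "tight_in_prob M (\<lambda>n \<omega>. R n \<omega> + S n \<omega>)"
  unfolding tight_in_prob_def
proof (intro conjI allI impI)
  note [measurable] = tight_in_prob_measurable[OF R] small_in_prob_measurable[OF S]
  show "(\<lambda>\<omega>. R n \<omega> + S n \<omega>) \<in> borel_measurable M" for n by measurable
  fix d :: real assume e: "d > 0"
  then obtain K where K: "K > 0"
    "eventually (\<lambda>n. prob {\<omega> \<in> space M. K < \<bar>R n \<omega>\<bar>} < d/2) sequentially"
    using R unfolding tight_in_prob_def by (meson half_gt_zero)
  have "eventually (\<lambda>n. prob {\<omega> \<in> space M. 1 < \<bar>S n \<omega>\<bar>} < d/2) sequentially"
    using e by (intro small_in_probD S; simp)
  with K(2) have "eventually (\<lambda>n. prob {\<omega> \<in> space M. K + 1 < \<bar>R n \<omega> + S n \<omega>\<bar>} < d) sequentially"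
    by eventually_elim
      (rule prob_less_if_subset_Un[of _ "{\<omega> \<in> space M. K < \<bar>R _ \<omega>\<bar>}" "{\<omega> \<in> space M. 1 < \<bar>S _ \<omega>\<bar>}"], auto)
  with K show "\<exists>K>0. eventually (\<lambda>n. prob {\<omega> \<in> space M. K < \<bar>R n \<omega> + S n \<omega>\<bar>} < d) sequentially"
    by (intro exI[of _ "K + 1"]) auto
qed

lemma prob_abs_gt_le_second_moment:
  assumes "integrable M (\<lambda>\<omega>. (f \<omega>)\<^sup>2)" "f \<in> borel_measurable M" "(a::real) > 0"
  shows "prob {\<omega> \<in> space M. a < \<bar>f \<omega>\<bar>} \<le> expectation (\<lambda>\<omega>. (f \<omega>)\<^sup>2) / a\<^sup>2"
proof -
  have "prob {\<omega> \<in> space M. a < \<bar>f \<omega>\<bar>} \<le> prob {\<omega> \<in> space M. \<bar>f \<omega>\<bar> \<ge> a}"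
    using assms(2) by (intro finite_measure_mono) auto
  also have "\<dots> \<le> expectation (\<lambda>\<omega>. (f \<omega>)\<^sup>2) / a\<^sup>2"
    using assms by (intro second_moment_method) auto
  finally show ?thesis .
qed

lemma tight_in_prob_second_moment:
  assumes [measurable]: "\<And>n. V n \<in> borel_measurable M"
    and int: "\<And>n. integrable M (\<lambda>\<omega>. (V n \<omega>)\<^sup>2)" and B: "\<And>n. expectation (\<lambda>\<omega>. (V n \<omega>)\<^sup>2) \<le> B"
  shows "tight_in_prob M V"
  unfolding tight_in_prob_def
proof (intro conjI allI impI)
  fix d :: real assume d: "d > 0"
  have "0 \<le> expectation (\<lambda>\<omega>. (V 0 \<omega>)\<^sup>2)" by simp
  with B[of 0] have B0: "B \<ge> 0" by linarith
  \<comment> \<open>Chebyshev gives the bound B / K^2 = d B / (B + 1). The summand 1 makes it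
    strictly less than d and keeps K positive when B = 0.\<close>
  define K where "K = sqrt ((B + 1)/ d) "
  have K: "K > 0" "K\<^sup>2 = (B+1)/d" using d B0 by (auto simp: K_def)
  have "prob {\<omega> \<in> space M. K < \<bar>V n \<omega>\<bar>} < d" for n
  proof -
    have "prob {\<omega> \<in> space M. K < \<bar>V n \<omega>\<bar>} \<le> expectation (\<lambda>\<omega>. (V n \<omega>)\<^sup>2) / K\<^sup>2"
      by (rule prob_abs_gt_le_second_moment) (use K int in auto)
    also have "\<dots> \<le> B / K\<^sup>2" using B by (intro divide_right_mono) auto
    also have "\<dots> < d" using d B0 by (simp add: K field_simps)
    finally show ?thesis .
  qed
  with K show "\<exists>K>0. eventually (\<lambda>n. prob {\<omega> \<in> space M. K < \<bar>V n \<omega>\<bar>} < d) sequentially"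
    by (intro exI[of _ K]) auto
qed (use assms in auto)

lemma small_in_prob_second_moment:
  assumes [measurable]: "\<And>n. V n \<in> borel_measurable M"
    and int: "\<And>n. integrable M (\<lambda>\<omega>. (V n \<omega>)\<^sup>2)"
    and B: "\<And>n. expectation (\<lambda>\<omega>. (V n \<omega>)\<^sup>2) \<le> b n" and b: "b \<longlonglongrightarrow> 0"
  shows "small_in_prob M V"
proof (rule small_in_probI)
  fix e d :: real assume d: "e > 0" "d > 0"
  have "(\<lambda>n. b n / e\<^sup>2) \<longlonglongrightarrow> 0 / e\<^sup>2" using b d by (intro tendsto_intros) auto
  then have "eventually (\<lambda>n. b n / e\<^sup>2 < d) sequentially"
    using d by (intro order_tendstoD) auto
  then show "eventually (\<lambda>n. prob {\<omega> \<in> space M. e < \<bar>V n \<omega>\<bar>} < d) sequentially"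
  proof eventually_elim
    case (elim n)
    have "prob {\<omega> \<in> space M. e < \<bar>V n \<omega>\<bar>} \<le> expectation (\<lambda>\<omega>. (V n \<omega>)\<^sup>2) / e\<^sup>2"
      by (rule prob_abs_gt_le_second_moment) (use d int in auto)
    also have "\<dots> \<le> b n / e\<^sup>2" using B by (intro divide_right_mono) auto
    finally show ?case using elim by simp
  qed
qed (use assms in auto)

lemma tight_in_probE:
  assumes "tight_in_prob M V" "d > 0"
  obtains K where "K > 0" "eventually (\<lambda>n. prob {\<omega> \<in> space M. K < \<bar>V n \<omega>\<bar>} < d) sequentially"
  using assms unfolding tight_in_prob_def by blast

text \<open>A derivative at \<theta> alone bounds the linearisation error by (e / K) |y - \<theta>|
  for y within \<delta> of \<theta>. Where the scaled deviation is at most K, the scaled error is at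
  most e, and sqrt n > K / \<delta> forces T n into that neighbourhood.\<close>

lemma delta_method:
  fixes T :: "nat \<Rightarrow> 'a \<Rightarrow> real"
  assumes T: "\<And>n. T n \<in> borel_measurable M" and h[measurable]: "h \<in> borel_measurable borel"
    and V: "tight_in_prob M (\<lambda>n \<omega>. sqrt (real n) * (T n \<omega> - \<theta>))"
    and D: "(h has_real_derivative D) (at \<theta>)"
  shows "small_in_prob M (\<lambda>n \<omega>. sqrt (real n) * (h (T n \<omega>) - h \<theta>) - D * (sqrt (real n) * (T n \<omega> - \<theta>)))"
proof (rule small_in_probI)
  note [measurable] = T
  show "(\<lambda>\<omega>. sqrt (real n) * (h (T n \<omega>) - h \<theta>) - D * (sqrt (real n) * (T n \<omega> - \<theta>))) \<in> borel_measurable M" for n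
    by measurable
  fix e d :: real assume ed: "e > 0" "d > 0"
  obtain K where K: "K > 0"
    "eventually (\<lambda>n. prob {\<omega> \<in> space M. K < \<bar>sqrt (real n) * (T n \<omega> - \<theta>)\<bar>} < d) sequentially"
    using tight_in_probE[OF V ed(2)] by blast
  have "(h has_derivative (*) D) (at \<theta>)"
    using D by (simp add: has_field_derivative_def)
  then have "\<forall>e'>0. \<exists>d>0. \<forall>y. norm (y - \<theta>) < d \<longrightarrow> norm (h y - h \<theta> - D * (y - \<theta>)) \<le> e' * norm (y - \<theta>)"
    unfolding has_derivative_at_alt by blast
  moreover have "e / K > 0" using ed K by simp
  ultimately obtain \<delta> where \<delta>: "\<delta> > 0"
    "\<And>y. \<bar>y - \<theta>\<bar> < \<delta> \<Longrightarrow> \<bar>h y - h \<theta> - D * (y - \<theta>)\<bar> \<le> (e/K) * \<bar>y - \<theta>\<bar>"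
    unfolding real_norm_def by blast
  have "filterlim (\<lambda>n. sqrt (real n)) at_top sequentially"
    by (rule filterlim_compose[OF sqrt_at_top filterlim_real_sequentially])
  then have "eventually (\<lambda>n. sqrt (real n) > K/\<delta>) sequentially"
    by (auto simp: filterlim_at_top_dense)
  with K(2) show "eventually (\<lambda>n. prob {\<omega> \<in> space M.
      e < \<bar>sqrt (real n) * (h (T n \<omega>) - h \<theta>) - D * (sqrt (real n) * (T n \<omega> - \<theta>))\<bar>} < d) sequentially"
  proof eventually_elim
    case (elim n)
    have "e \<ge> \<bar>sqrt (real n) * (h (T n \<omega>) - h \<theta>) - D * (sqrt (real n) * (T n \<omega> - \<theta>))\<bar>"
      if le: "\<bar>sqrt (real n) * (T n \<omega> - \<theta>)\<bar> \<le> K" for \<omega>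
    proof -
      let ?y = "T n \<omega>"
      have n0: "sqrt (real n) > 0" using elim K \<delta> by (meson divide_pos_pos less_trans)
      have "sqrt (real n) * \<bar>?y - \<theta>\<bar> \<le> K" using le by (simp add: abs_mult)
      also have "K < sqrt (real n) * \<delta>" using elim \<delta> by (simp add: field_simps)
      finally have "\<bar>?y - \<theta>\<bar> < \<delta>" using n0 by simp
      from \<delta>(2)[OF this] have "sqrt (real n) * \<bar>h ?y - h \<theta> - D * (?y - \<theta>)\<bar> \<le> sqrt (real n) * ((e/K) * \<bar>?y - \<theta>\<bar>)"
        using n0 by (intro mult_left_mono) auto
      also have "\<dots> = (e/K) * \<bar>sqrt (real n) * (?y - \<theta>)\<bar>" by (simp add: abs_mult)
      also have "\<dots> \<le> (e/K) * K" using ed K le by (intro mult_left_mono) auto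
      also have "\<dots> = e" using K by simp
      also have "sqrt (real n) * \<bar>h ?y - h \<theta> - D * (?y - \<theta>)\<bar> = \<bar>sqrt (real n) * (h ?y - h \<theta> - D * (?y - \<theta>))\<bar>"
        by (simp add: abs_mult)
      also have "sqrt (real n) * (h ?y - h \<theta> - D * (?y - \<theta>)) =
          sqrt (real n) * (h ?y - h \<theta>) - D * (sqrt (real n) * (?y - \<theta>))"
        by (simp add: algebra_simps)
      finally show ?thesis .
    qed
    note bd = this[unfolded not_less[symmetric]]
    have "prob {\<omega> \<in> space M.
      e < \<bar>sqrt (real n) * (h (T n \<omega>) - h \<theta>) - D * (sqrt (real n) * (T n \<omega> - \<theta>))\<bar>}
      \<le> prob {\<omega> \<in> space M. K < \<bar>sqrt (real n) * (T n \<omega> - \<theta>)\<bar>}"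
      using bd by (intro finite_measure_mono) (blast, measurable)
    with elim show ?case by simp
  qed
qed

text \<open>If V and W differ by more than e while W stays in [-K, K], then some point of a finite
  grid of mesh e/2 separates them with a gap of at least e/2 to spare. Each grid point contributes
  two events whose probabilities vanish, and their number does not depend on n. Tightness is asked
  of W only, so that tightness of V can be a conclusion.\<close>

lemma small_in_prob_diff_ghosh:
  fixes V W :: "nat \<Rightarrow> 'a \<Rightarrow> real"
  assumes V[measurable]: "\<And>n. V n \<in> borel_measurable M" and W: "tight_in_prob M W"
    and le: "\<And>t e. e > 0 \<Longrightarrow> (\<lambda>n. prob {\<omega> \<in> space M. V n \<omega> \<le> t \<and> W n \<omega> \<ge> t + e}) \<longlonglongrightarrow> 0"
    and ge: "\<And>t e. e > 0 \<Longrightarrow> (\<lambda>n. prob {\<omega> \<in> space M. V n \<omega> \<ge> t + e \<and> W n \<omega> \<le> t}) \<longlonglongrightarrow> 0"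
  shows "small_in_prob M (\<lambda>n \<omega>. V n \<omega> - W n \<omega>)"
proof (rule small_in_probI)
  note W_meas[measurable] = tight_in_prob_measurable[OF W]
  show "(\<lambda>\<omega>. V n \<omega> - W n \<omega>) \<in> borel_measurable M" for n by measurable
  fix e d :: real assume e: "e > 0" "d > 0"
  obtain K where K: "K > 0" "eventually (\<lambda>n. prob {\<omega> \<in> space M. K < \<bar>W n \<omega>\<bar>} < d/2) sequentially"
    using tight_in_probE[OF W, of "d/2"] e by auto
  \<comment> \<open>Steps of length e/2 starting at -(K + e) pass K + e after 4 (K + e) / e
    steps.\<close>
  define N where "N = nat \<lceil>4 * (K + e) / e\<rceil>"
  define t where "t j = - (K + e) + real j * (e / 2)" for j
  define A where "A n j = {\<omega> \<in> space M. V n \<omega> \<le> t j \<and> W n \<omega> \<ge> t j + e/2}" for n j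
  define B where "B n j = {\<omega> \<in> space M. V n \<omega> \<ge> t j + e/2 \<and> W n \<omega> \<le> t j}" for n j
  have AB[measurable]: "A n j \<in> events" "B n j \<in> events" for n j by (auto simp: A_def B_def)
  have "(\<lambda>n. \<Sum>j\<in>{..N+1}. prob (A n j) + prob (B n j)) \<longlonglongrightarrow> (\<Sum>j\<in>{..N+1}. 0 + 0)"
    unfolding A_def B_def by (intro tendsto_intros le ge) (use e in auto)
  then have "eventually (\<lambda>n. (\<Sum>j\<in>{..N+1}. prob (A n j) + prob (B n j)) < d/2) sequentially"
    using e by (intro order_tendstoD) auto
  with K(2) show "eventually (\<lambda>n. prob {\<omega> \<in> space M. e < \<bar>V n \<omega> - W n \<omega>\<bar>} < d) sequentially"
  proof eventually_elim
    case (elim n)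
    have "prob (\<Union>j\<in>{..N+1}. A n j \<union> B n j) \<le> (\<Sum>j\<in>{..N+1}. prob (A n j \<union> B n j))"
      by (intro finite_measure_subadditive_finite) auto
    also have "\<dots> \<le> (\<Sum>j\<in>{..N+1}. prob (A n j) + prob (B n j))"
      by (intro sum_mono measure_Un_le) auto
    finally have le2: "prob (\<Union>j\<in>{..N+1}. A n j \<union> B n j) < d/2" using elim by simp
    have grid: "\<exists>j\<le>N+1. w \<le> t j \<and> t j < w + e/2" if w: "\<bar>w\<bar> \<le> K + e" for w
    proof -
      define j where "j = nat \<lceil>(w + (K + e)) / (e/2)\<rceil>"
      have nn: "(w + (K + e)) / (e/2) \<ge> 0" using w e by (auto intro!: divide_nonneg_pos)
      have j: "real j \<ge> (w + (K + e)) / (e/2)" "real j < (w + (K + e)) / (e/2) + 1"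
        unfolding j_def using nn by linarith+
      have "(w + (K + e)) / (e/2) \<le> 4*(K + e)/e"
      proof -
        have "(w + (K + e)) / (e/2) \<le> (2*(K + e)) / (e/2)" using w e by (intro divide_right_mono) auto
        then show ?thesis by simp
      qed
      then have "j \<le> N + 1" unfolding j_def N_def using nn by linarith
      moreover have "w \<le> t j" "t j < w + e/2"
        using j e unfolding t_def by (auto simp: field_simps)
      ultimately show ?thesis by blast
    qed
    have "{\<omega> \<in> space M. e < \<bar>V n \<omega> - W n \<omega>\<bar>} \<subseteq>
        (\<Union>j\<in>{..N+1}. A n j \<union> B n j) \<union> {\<omega> \<in> space M. K < \<bar>W n \<omega>\<bar>}"
    proof
      fix \<omega> assume "\<omega> \<in> {\<omega> \<in> space M. e < \<bar>V n \<omega> - W n \<omega>\<bar>}"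
      then have \<omega>: "\<omega> \<in> space M" "e < \<bar>V n \<omega> - W n \<omega>\<bar>" by auto
      show "\<omega> \<in> (\<Union>j\<in>{..N+1}. A n j \<union> B n j) \<union> {\<omega> \<in> space M. K < \<bar>W n \<omega>\<bar>}"
      proof (cases "\<bar>W n \<omega>\<bar> \<le> K")
        case True
        note wK = this
        show ?thesis
        proof (cases "V n \<omega> - W n \<omega> > e")
          case True
          have "\<bar>W n \<omega>\<bar> \<le> K + e" using wK e by linarith
          from grid[OF this] obtain j where j: "j \<le> N+1" "W n \<omega> \<le> t j" "t j < W n \<omega> + e/2" by blast
          then have "\<omega> \<in> B n j" using True \<omega> by (auto simp: B_def)
          with j show ?thesis by blast
        next
          \<comment> \<open>Here the grid point is sought just above W - e instead of W, so that it
            lies above V and at least e/2 below W. This shift is why the grid extends to K + e on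
            both sides.\<close>
          case False
          then have f: "W n \<omega> - V n \<omega> > e" using \<omega> by linarith
          have "\<bar>W n \<omega> - e\<bar> \<le> K + e" using wK e by linarith
          from grid[OF this] obtain j where j: "j \<le> N+1" "W n \<omega> - e \<le> t j" "t j < W n \<omega> - e + e/2" by blast
          then have "\<omega> \<in> A n j" using f \<omega> by (auto simp: A_def)
          with j show ?thesis by blast
        qed
      qed (use \<omega> in auto)
    qed
    then show ?case
      by (rule prob_less_if_subset_Un[OF _ _ _ le2 elim(1)]) measurable
  qed
qed

end

section \<open>The Cramer-Wold device in the plane\<close>

text \<open>The test functions whose expectations a central limit theorem for linear combinations
  controls. The phase t supplies sines and constants, and the product-to-sum formula makes the class
  an algebra.\<close>

inductive trig_sum :: "(real \<times> real \<Rightarrow> real) \<Rightarrow> bool" where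
  cos: "trig_sum (\<lambda>z. c * cos (a * fst z + b * snd z + t))"
| add: "trig_sum f \<Longrightarrow> trig_sum g \<Longrightarrow> trig_sum (\<lambda>z. f z + g z)"

lemma trig_sum_mult_cos:
  "trig_sum g \<Longrightarrow> trig_sum (\<lambda>z. (c * cos (a * fst z + b * snd z + t)) * g z)"
proof (induction rule: trig_sum.induct)
  case (cos c' a' b' t')
  have "(\<lambda>z::real\<times>real. (c * cos (a * fst z + b * snd z + t)) * (c' * cos (a' * fst z + b' * snd z + t'))) =
    (\<lambda>z. (c * c' / 2) * cos ((a - a') * fst z + (b - b') * snd z + (t - t')) +
         (c * c' / 2) * cos ((a + a') * fst z + (b + b') * snd z + (t + t')))"
  proof
    fix z :: "real \<times> real"
    define u w where "u = a * fst z + b * snd z + t" and "w = a' * fst z + b' * snd z + t'"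
    have uw: "(a - a') * fst z + (b - b') * snd z + (t - t') = u - w"
      "(a + a') * fst z + (b + b') * snd z + (t + t') = u + w"
      by (auto simp: u_def w_def algebra_simps)
    have "(c * cos u) * (c' * cos w) = (c * c' / 2) * cos (u - w) + (c * c' / 2) * cos (u + w)"
      by (simp add: cos_add cos_diff algebra_simps)
    then show "(c * cos (a * fst z + b * snd z + t)) * (c' * cos (a' * fst z + b' * snd z + t')) =
      (c * c' / 2) * cos ((a - a') * fst z + (b - b') * snd z + (t - t')) +
         (c * c' / 2) * cos ((a + a') * fst z + (b + b') * snd z + (t + t'))"
      unfolding uw unfolding u_def w_def .
  qed
  then show ?case by (simp only:) (intro trig_sum.intros)
next
  case (add f g)
  then show ?case by (simp only: distrib_left) (rule trig_sum.add)
qed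

lemma trig_sum_mult:
  assumes "trig_sum f" "trig_sum g" shows "trig_sum (\<lambda>z. f z * g z)"
  using assms(1)
proof (induction rule: trig_sum.induct)
  case cos
  show ?case by (rule trig_sum_mult_cos) fact
next
  case (add f g')
  then show ?case by (simp only: distrib_right) (rule trig_sum.add)
qed

lemma trig_sum_const: "trig_sum (\<lambda>z. c)"
  using trig_sum.cos[of c 0 0 0] by simp

lemma trig_sum_sin: "trig_sum (\<lambda>z. c * sin (a * fst z + b * snd z))"
  using trig_sum.cos[of c a b "- (pi/2)"] by (simp add: cos_diff)

text \<open>A linear functional on the plane is fixed by its values at the two unit vectors, so it
  turns into a combination of two sines; sums and products of polynomials stay in the
  algebra.\<close>

lemma trig_sum_polynomial:
  fixes P :: "real \<times> real \<Rightarrow> real"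
  assumes "real_polynomial_function P"
  shows "trig_sum (\<lambda>z. P (sin (fst z / L), sin (snd z / L)))"
  using assms
proof (induction rule: real_polynomial_function.induct)
  case (linear f)
  interpret bounded_linear f by fact
  have f_eq: "f (x, y) = f (1, 0) * x + f (0, 1) * y" for x y
  proof -
    have "(x, y) = x *\<^sub>R (1, 0) + y *\<^sub>R (0, 1)" by simp
    then show ?thesis by (simp only: add scaleR) simp
  qed
  have "(\<lambda>z. f (sin (fst z / L), sin (snd z / L))) =
     (\<lambda>z. f (1, 0) * sin ((1/L) * fst z + 0 * snd z) + f (0, 1) * sin (0 * fst z + (1/L) * snd z))"
    by (rule ext, subst f_eq, simp)
  then show ?case by (simp only:) (intro trig_sum.add trig_sum_sin)
qed (auto intro: trig_sum_const trig_sum.add trig_sum_mult)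

lemma trig_sum_bounded: "trig_sum g \<Longrightarrow> \<exists>B. \<forall>z. \<bar>g z\<bar> \<le> B"
proof (induction rule: trig_sum.induct)
  case (cos c a b t)
  have "\<bar>c * cos x\<bar> \<le> \<bar>c\<bar>" for x
    using mult_left_mono[OF abs_cos_le_one[of x], of "\<bar>c\<bar>"] by (simp add: abs_mult)
  then show ?case by blast
next
  case (add f g)
  then obtain B C where "\<And>z. \<bar>f z\<bar> \<le> B" "\<And>z. \<bar>g z\<bar> \<le> C" by blast
  then have "\<bar>f z + g z\<bar> \<le> B + C" for z
    by (meson abs_triangle_ineq add_mono order_trans)
  then show ?case by blast
qed

lemma trig_sum_measurable: "trig_sum g \<Longrightarrow> g \<in> borel_measurable borel"
proof (induction rule: trig_sum.induct)
  case (cos c a b t)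
  show ?case by (intro borel_measurable_continuous_onI continuous_intros)
qed auto

lemma (in prob_space) integrable_bounded_borel:
  fixes g :: "'b::topological_space \<Rightarrow> real"
  assumes "g \<in> borel_measurable borel" "\<And>z. \<bar>g z\<bar> \<le> B" "Y \<in> measurable M borel"
  shows "integrable M (\<lambda>\<omega>. g (Y \<omega>))"
  using assms by (intro integrable_const_bound[of _ B]) (auto simp: measurable_compose)

lemma trig_sum_integral_tendsto:
  fixes Y :: "nat \<Rightarrow> 'a \<Rightarrow> real \<times> real"
  assumes M: "prob_space M" and N: "prob_space N" and sN: "sets N = sets borel"
    and Y: "\<And>n. Y n \<in> measurable M borel"
    and cos: "\<And>a b t. (\<lambda>n. \<integral>\<omega>. cos (a * fst (Y n \<omega>) + b * snd (Y n \<omega>) + t) \<partial>M)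
               \<longlonglongrightarrow> (\<integral>z. cos (a * fst z + b * snd z + t) \<partial>N)"
    and g: "trig_sum g"
  shows "(\<lambda>n. \<integral>\<omega>. g (Y n \<omega>) \<partial>M) \<longlonglongrightarrow> (\<integral>z. g z \<partial>N)"
  using g
proof (induction rule: trig_sum.induct)
  case (cos c a b t)
  show ?case using assms(5)[of a b t] by (simp add: tendsto_mult_left)
next
  case (add f g)
  have id: "(\<lambda>z. z) \<in> measurable N borel" using sN by (simp add: measurable_def sets_eq_imp_space_eq[OF sN])
  have "integrable M (\<lambda>\<omega>. h (Y n \<omega>))" "integrable N h" if "trig_sum h" for h n
    using trig_sum_bounded[OF that] trig_sum_measurable[OF that]
      prob_space.integrable_bounded_borel[OF M _ _ Y]
      prob_space.integrable_bounded_borel[OF N _ _ id] by blast+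
  with add show ?case by (auto intro!: tendsto_add)
qed

text \<open>The phases 0 and - pi/2 give the real and imaginary parts of the characteristic
  functions. Levy's continuity theorem then yields weak convergence to \<open>Q\<close>, and the
  tails of \<open>U n\<close> are compared with those of \<open>Q\<close> through a continuous
  ramp.\<close>

lemma (in prob_space) tight_in_prob_of_cos_tendsto:
  fixes U :: "nat \<Rightarrow> 'a \<Rightarrow> real"
  assumes Q: "real_distribution Q" and U[measurable]: "\<And>n. U n \<in> borel_measurable M"
    and cos: "\<And>a t. (\<lambda>n. \<integral>\<omega>. cos (a * U n \<omega> + t) \<partial>M) \<longlonglongrightarrow> (\<integral>x. cos (a * x + t) \<partial>Q)"
  shows "tight_in_prob M U"
proof -
  interpret Q: real_distribution Q by fact
  define D where "D n = distr M borel (U n)" for n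
  have D: "real_distribution (D n)" for n unfolding D_def by (rule real_distribution_distr) simp
  have ch: "char Q' t = Complex (\<integral>x. cos (t * x + 0) \<partial>Q') (\<integral>x. cos (t * x + - (pi/2)) \<partial>Q')"
    if "real_distribution Q'" for Q' t
  proof -
    interpret Q': real_distribution Q' by fact
    have int: "integrable Q' (\<lambda>x. iexp (t * x))" by (rule Q'.integrable_iexp) auto
    have "Re (char Q' t) = (\<integral>x. cos (t * x + 0) \<partial>Q')"
      unfolding char_def integral_Re[OF int, symmetric] by (simp add: Re_exp)
    moreover have "Im (char Q' t) = (\<integral>x. cos (t * x + - (pi/2)) \<partial>Q')"
      unfolding char_def integral_Im[OF int, symmetric] by (simp add: Im_exp cos_diff)
    ultimately show ?thesis by (simp add: complex_eq_iff)
  qed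
  have cv: "(\<lambda>n. \<integral>x. cos (a * x + t) \<partial>D n) \<longlonglongrightarrow> (\<integral>x. cos (a * x + t) \<partial>Q)" for a t
    unfolding D_def using cos by (simp add: integral_distr)
  have "(\<lambda>n. char (D n) t) \<longlonglongrightarrow> char Q t" for t
    unfolding ch[OF D] ch[OF Q] by (intro tendsto_Complex cv)
  then have wc: "weak_conv_m D Q" by (intro levy_continuity D Q)
  show ?thesis
    unfolding tight_in_prob_def
  proof (intro conjI allI impI)
    fix d :: real assume d: "d > 0"
    \<comment> \<open>A continuous ramp: it vanishes for |x| \<le> K and equals 1 for |x| \<ge> K +
      1, so it lies above the indicator of |x| > K + 1.\<close>
    define \<psi> where "\<psi> K x = min 1 (max 0 (\<bar>x\<bar> - K))" for K x :: real
    have \<psi>c: "isCont (\<psi> K) x" for K x unfolding \<psi>_def by (intro continuous_intros)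
    have \<psi>m[measurable]: "\<psi> K \<in> borel_measurable borel" for K unfolding \<psi>_def by measurable
    have \<psi>b: "norm (\<psi> K x) \<le> 1" for K x unfolding \<psi>_def by auto
    have "(\<lambda>k. \<integral>x. \<psi> (real k) x \<partial>Q) \<longlonglongrightarrow> (\<integral>x. 0 \<partial>Q)"
    proof (rule integral_dominated_convergence[where w = "\<lambda>_. 1"])
      show "AE x in Q. (\<lambda>k. \<psi> (real k) x) \<longlonglongrightarrow> 0"
      proof (rule always_eventually, rule allI, rule tendsto_eventually)
        fix x :: real
        show "\<forall>\<^sub>F k in sequentially. \<psi> (real k) x = 0"
          using eventually_ge_at_top[of "nat \<lceil>\<bar>x\<bar>\<rceil>"]
          by eventually_elim (auto simp: \<psi>_def)
      qed
    qed (use \<psi>b in auto)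
    then have "eventually (\<lambda>k. (\<integral>x. \<psi> (real k) x \<partial>Q) < d) sequentially"
      using d by (intro order_tendstoD) auto
    then obtain k where k: "(\<integral>x. \<psi> (real k) x \<partial>Q) < d" by (auto simp: eventually_sequentially)
    have "(\<lambda>n. integral\<^sup>L (D n) (\<psi> k)) \<longlonglongrightarrow> integral\<^sup>L Q (\<psi> k)"
      by (rule weak_conv_imp_integral_bdd_continuous_conv[OF D Q wc \<psi>c \<psi>b])
    then have "eventually (\<lambda>n. integral\<^sup>L (D n) (\<psi> k) < d) sequentially"
      using k by (intro order_tendstoD) auto
    then have "eventually (\<lambda>n. prob {\<omega> \<in> space M. real k + 1 < \<bar>U n \<omega>\<bar>} < d) sequentially"
    proof eventually_elim
      case (elim n)
      have "prob {\<omega> \<in> space M. real k + 1 < \<bar>U n \<omega>\<bar>} =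
          expectation (indicator {\<omega> \<in> space M. real k + 1 < \<bar>U n \<omega>\<bar>})" by simp
      also have "\<dots> \<le> expectation (\<lambda>\<omega>. \<psi> k (U n \<omega>))"
        using integrable_bounded_borel[OF \<psi>m \<psi>b[unfolded real_norm_def] U]
        by (intro integral_mono) (auto simp: \<psi>_def indicator_def less_top[symmetric])
      also have "\<dots> = integral\<^sup>L (D n) (\<psi> k)" by (simp add: D_def integral_distr)
      finally show ?case using elim by simp
    qed
    then show "\<exists>K>0. eventually (\<lambda>n. prob {\<omega> \<in> space M. K < \<bar>U n \<omega>\<bar>} < d) sequentially"
      by (intro exI[of _ "real k + 1"]) auto
  qed (rule U)
qed

lemma (in prob_space) expectation_diff_le:
  fixes f g :: "'a \<Rightarrow> real"
  assumes "integrable M f" "integrable M g" "A \<in> events"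
    and le: "\<And>\<omega>. \<omega> \<in> space M \<Longrightarrow> \<bar>f \<omega> - g \<omega>\<bar> \<le> e + C * indicator A \<omega>"
  shows "\<bar>expectation f - expectation g\<bar> \<le> e + C * prob A"
proof -
  have "\<bar>expectation f - expectation g\<bar> = \<bar>expectation (\<lambda>\<omega>. f \<omega> - g \<omega>)\<bar>" using assms by simp
  also have "\<dots> \<le> expectation (\<lambda>\<omega>. \<bar>f \<omega> - g \<omega>\<bar>)" by (rule integral_abs_bound)
  also have "\<dots> \<le> expectation (\<lambda>\<omega>. e + C * indicator A \<omega>)"
    using assms by (intro integral_mono) (auto simp: less_top[symmetric])
  also have "\<dots> = e + C * prob A" using assms(3) by (simp add: prob_space less_top[symmetric])
  finally show ?thesis .
qed

text \<open>On a large box a bounded continuous \<open>f\<close> is approximated by \<open>P (sin (x/K), sin (y/K))\<close>,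
  where the polynomial \<open>P\<close> approximates \<open>f (K arcsin s, K arcsin t)\<close> on \<open>[-1,1]\<^sup>2\<close>; the
  approximation is a trigonometric sum and stays bounded outside the box.\<close>

lemma trig_sum_approx:
  fixes f :: "real \<times> real \<Rightarrow> real"
  assumes f: "continuous_on UNIV f" and B: "\<And>z. \<bar>f z\<bar> \<le> B" and e: "e > 0" and K: "K > 0"
  obtains g where "trig_sum g"
    and "\<And>z. \<bar>f z - g z\<bar> \<le> e + 2 * B * indicator {z. K < \<bar>fst z\<bar> \<or> K < \<bar>snd z\<bar>} z"
proof -
  let ?S = "{-1..1::real} \<times> {-1..1::real}"
  let ?F = "\<lambda>z. f (K * arcsin (fst z), K * arcsin (snd z))"
  have "continuous_on ?S ?F"
    by (intro continuous_on_compose2[OF f] continuous_intros) auto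
  then obtain P where P: "real_polynomial_function P" "\<And>x. x \<in> ?S \<Longrightarrow> \<bar>?F x - P x\<bar> < e"
    using Stone_Weierstrass_real_polynomial_function[of ?S ?F e] e compact_Times[OF compact_Icc compact_Icc] by blast
  define g where "g z = P (sin (fst z / K), sin (snd z / K))" for z
  have "\<bar>f z - g z\<bar> \<le> e + 2 * B * indicator {z. K < \<bar>fst z\<bar> \<or> K < \<bar>snd z\<bar>} z" for z
  proof -
    let ?w = "(sin (fst z / K), sin (snd z / K))"
    have ap: "\<bar>?F ?w - g z\<bar> < e" unfolding g_def by (rule P) auto
    show ?thesis
    proof (cases "K < \<bar>fst z\<bar> \<or> K < \<bar>snd z\<bar>")
      case True
      \<comment> \<open>Outside the box g is within e of the value of f at another point, and two
        values of f differ by at most 2 B.\<close>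
      then show ?thesis using ap B[of z] B[of "(K * arcsin (fst ?w), K * arcsin (snd ?w))"] by simp
    next
      case False
      have "K * arcsin (sin (x / K)) = x" if "\<not> K < \<bar>x\<bar>" for x
      proof -
        have "\<bar>x / K\<bar> \<le> 1" using that K by (simp add: field_simps)
        \<comment> \<open>Scaling the box to [-1, 1] keeps it inside [- pi/2, pi/2], where arcsin
          inverts sin.\<close>
        then have "\<bar>x / K\<bar> \<le> pi / 2" using pi_ge_two by linarith
        then have "arcsin (sin (x / K)) = x / K" by (intro arcsin_sin) linarith+
        then show ?thesis using K by simp
      qed
      then have "?F ?w = f z" using False by simp
      then show ?thesis using ap False by simp
    qed
  qed
  then show ?thesis using that trig_sum_polynomial[OF P(1), of K] unfolding g_def by blast
qed

text \<open>The hypothesis gives convergence for all trigonometric sums g. Replacing f by g costs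
  little both under the law of \<open>Y n\<close> and under \<open>N\<close>, because both give
  small mass to the complement of a large box, the former for large n.\<close>

lemma conv_distr2_of_cos_tendsto:
  fixes Y :: "nat \<Rightarrow> 'a \<Rightarrow> real \<times> real"
  assumes M: "prob_space M" and N: "prob_space N" and sN: "sets N = sets borel"
    and Y[measurable]: "\<And>n. Y n \<in> measurable M borel"
    and cos: "\<And>a b t. (\<lambda>n. \<integral>\<omega>. cos (a * fst (Y n \<omega>) + b * snd (Y n \<omega>) + t) \<partial>M)
               \<longlonglongrightarrow> (\<integral>z. cos (a * fst z + b * snd z + t) \<partial>N)"
  shows "conv_distr2 M Y N"
  unfolding conv_distr2_def
proof (intro allI impI, elim conjE)
  interpret M: prob_space M by fact
  interpret N: prob_space N by fact
  have id: "(\<lambda>z. z) \<in> measurable N borel" using sN by (simp add: measurable_def sets_eq_imp_space_eq[OF sN])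
  have fs0: "fst \<in> borel_measurable (borel :: (real \<times> real) measure)" "snd \<in> borel_measurable (borel :: (real \<times> real) measure)"
    by (intro borel_measurable_continuous_onI continuous_intros)+
  have fsN[measurable]: "fst \<in> borel_measurable N" "snd \<in> borel_measurable N"
    using fs0 measurable_cong_sets[OF sN refl] by blast+
  have fsY[measurable]: "(\<lambda>\<omega>. fst (Y n \<omega>)) \<in> borel_measurable M" "(\<lambda>\<omega>. snd (Y n \<omega>)) \<in> borel_measurable M" for n
    using measurable_compose[OF Y fs0(1)] measurable_compose[OF Y fs0(2)] by auto
  have Q: "real_distribution (distr N borel fst)" "real_distribution (distr N borel snd)"
    by (rule N.real_distribution_distr, simp)+
  have t: "tight_in_prob M (\<lambda>n \<omega>. fst (Y n \<omega>))" "tight_in_prob M (\<lambda>n \<omega>. snd (Y n \<omega>))"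
    using cos[of _ 0] cos[of 0]
    by (intro M.tight_in_prob_of_cos_tendsto[OF Q(1)] M.tight_in_prob_of_cos_tendsto[OF Q(2)];
        simp add: integral_distr)+
  \<comment> \<open>Tightness of the single law \<open>N\<close> is obtained by viewing it as a
    constant sequence that converges to its own marginals.\<close>
  have tN: "tight_in_prob N (\<lambda>n::nat. fst)" "tight_in_prob N (\<lambda>n::nat. snd)"
    by (intro N.tight_in_prob_of_cos_tendsto[OF Q(1)] N.tight_in_prob_of_cos_tendsto[OF Q(2)];
        simp add: integral_distr)+
  fix f :: "real \<times> real \<Rightarrow> real"
  assume f: "continuous_on UNIV f" and "bounded (range f)"
  then obtain B where B: "B > 0" "\<And>z. \<bar>f z\<bar> \<le> B"
    by (auto simp: bounded_pos)
  have fm[measurable]: "f \<in> borel_measurable borel" using f by (rule borel_measurable_continuous_onI)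
  show "(\<lambda>n. \<integral>\<omega>. f (Y n \<omega>) \<partial>M) \<longlonglongrightarrow> (\<integral>z. f z \<partial>N)"
  proof (rule LIMSEQ_I)
    fix e :: real assume e: "e > 0"
    \<comment> \<open>The exchange of f for g costs less than 2 \<epsilon> on each side and the
      convergence for g less than \<epsilon>, in total 5 \<epsilon> < e. The choice of d makes 2 B d
      = \<epsilon>, the contribution of the complement of the box.\<close>
    define \<epsilon> where "\<epsilon> = e / 6"
    define d where "d = \<epsilon> / (2 * B)"
    have ed: "\<epsilon> > 0" "d > 0" using e B by (auto simp: \<epsilon>_def d_def)
    have "\<exists>K>0. eventually (\<lambda>n. M.prob {\<omega> \<in> space M. K < \<bar>fst (Y n \<omega>)\<bar>} < d/2) sequentially"
         "\<exists>K>0. eventually (\<lambda>n. M.prob {\<omega> \<in> space M. K < \<bar>snd (Y n \<omega>)\<bar>} < d/2) sequentially"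
         "\<exists>K>0. eventually (\<lambda>n::nat. N.prob {z \<in> space N. K < \<bar>fst z\<bar>} < d/2) sequentially"
         "\<exists>K>0. eventually (\<lambda>n::nat. N.prob {z \<in> space N. K < \<bar>snd z\<bar>} < d/2) sequentially"
      using t tN ed unfolding tight_in_prob_def by (meson half_gt_zero)+
    then obtain K1 K2 K3 K4 where Ks: "K1 > 0" "K2 > 0" "K3 > 0" "K4 > 0"
       "eventually (\<lambda>n. M.prob {\<omega> \<in> space M. K1 < \<bar>fst (Y n \<omega>)\<bar>} < d/2) sequentially"
       "eventually (\<lambda>n. M.prob {\<omega> \<in> space M. K2 < \<bar>snd (Y n \<omega>)\<bar>} < d/2) sequentially"
       "N.prob {z \<in> space N. K3 < \<bar>fst z\<bar>} < d/2" "N.prob {z \<in> space N. K4 < \<bar>snd z\<bar>} < d/2"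
      by (auto simp: eventually_const)
    define K where "K = max (max K1 K2) (max K3 K4)"
    have K: "K > 0" "K1 \<le> K" "K2 \<le> K" "K3 \<le> K" "K4 \<le> K" using Ks by (auto simp: K_def)
    define A where "A = {z :: real \<times> real. K < \<bar>fst z\<bar> \<or> K < \<bar>snd z\<bar>}"
    obtain g where g: "trig_sum g" "\<And>z. \<bar>f z - g z\<bar> \<le> \<epsilon> + 2 * B * indicator A z"
      using trig_sum_approx[OF f B(2) ed(1) K(1)] unfolding A_def by blast
    obtain C where C: "\<And>z. \<bar>g z\<bar> \<le> C" using trig_sum_bounded[OF g(1)] by blast
    note gm[measurable] = trig_sum_measurable[OF g(1)]
    have dB: "2 * B * d = \<epsilon>" using B by (simp add: d_def)
    have N1: "\<bar>N.expectation f - N.expectation g\<bar> < 2 * \<epsilon>"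
    proof -
      have AN: "A \<inter> space N = {z \<in> space N. K < \<bar>fst z\<bar> \<or> K < \<bar>snd z\<bar>}" by (auto simp: A_def)
      have [measurable]: "A \<inter> space N \<in> sets N" unfolding AN by measurable
      have "N.prob (A \<inter> space N) < d"
        by (rule N.prob_less_if_subset_Un[OF _ _ _ Ks(7,8)]) (use K in \<open>auto simp: A_def\<close>)
      then have "2 * B * N.prob (A \<inter> space N) < \<epsilon>"
        using B by (subst dB[symmetric]) simp
      moreover have "\<bar>N.expectation f - N.expectation g\<bar> \<le> \<epsilon> + 2 * B * N.prob (A \<inter> space N)"
        using g(2) N.integrable_bounded_borel[OF fm B(2) id] N.integrable_bounded_borel[OF gm C id]
        by (intro N.expectation_diff_le) (auto simp: indicator_def)
      ultimately show ?thesis by linarith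
    qed
    have "(\<lambda>n. \<integral>\<omega>. g (Y n \<omega>) \<partial>M) \<longlonglongrightarrow> (\<integral>z. g z \<partial>N)"
      by (rule trig_sum_integral_tendsto[OF M N sN Y cos g(1)])
    then have "eventually (\<lambda>n. \<bar>(\<integral>\<omega>. g (Y n \<omega>) \<partial>M) - (\<integral>z. g z \<partial>N)\<bar> < \<epsilon>) sequentially"
      using ed by (auto simp: tendsto_iff dist_real_def)
    with Ks(5,6) have "eventually (\<lambda>n. norm ((\<integral>\<omega>. f (Y n \<omega>) \<partial>M) - (\<integral>z. f z \<partial>N)) < e) sequentially"
    proof eventually_elim
      case (elim n)
      define A' where "A' = {\<omega> \<in> space M. K < \<bar>fst (Y n \<omega>)\<bar> \<or> K < \<bar>snd (Y n \<omega>)\<bar>}"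
      have [measurable]: "A' \<in> sets M" unfolding A'_def by measurable
      have "M.prob A' < d"
        by (rule M.prob_less_if_subset_Un[OF _ _ _ elim(1,2)]) (use K in \<open>auto simp: A'_def\<close>)
      then have "2 * B * M.prob A' < \<epsilon>"
        using B by (subst dB[symmetric]) simp
      moreover have "\<bar>M.expectation (\<lambda>\<omega>. f (Y n \<omega>)) - M.expectation (\<lambda>\<omega>. g (Y n \<omega>))\<bar> \<le> \<epsilon> + 2 * B * M.prob A'"
      proof (rule M.expectation_diff_le)
        fix \<omega> assume "\<omega> \<in> space M"
        then have "indicator A (Y n \<omega>) = (indicator A' \<omega> :: real)" by (auto simp: A_def A'_def indicator_def)
        with g(2)[of "Y n \<omega>"] show "\<bar>f (Y n \<omega>) - g (Y n \<omega>)\<bar> \<le> \<epsilon> + 2 * B * indicator A' \<omega>" by simp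
      qed (use M.integrable_bounded_borel[OF fm B(2) Y] M.integrable_bounded_borel[OF gm C Y] in auto)
      ultimately have "\<bar>M.expectation (\<lambda>\<omega>. f (Y n \<omega>)) - M.expectation (\<lambda>\<omega>. g (Y n \<omega>))\<bar> < 2 * \<epsilon>" by linarith
      with N1 elim(3) have "\<bar>(\<integral>\<omega>. f (Y n \<omega>) \<partial>M) - (\<integral>z. f z \<partial>N)\<bar> < 5 * \<epsilon>" by linarith
      then show ?case using e by (simp add: \<epsilon>_def)
    qed
    then show "\<exists>no. \<forall>n\<ge>no. norm ((\<integral>\<omega>. f (Y n \<omega>) \<partial>M) - (\<integral>z. f z \<partial>N)) < e"
      by (simp add: eventually_sequentially)
  qed
qed

section \<open>Bivariate normal laws\<close>

text \<open>Scaling a standard normal variable by sqrt v covers the point mass at v = 0 as well,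
  which spares later arguments the case distinction.\<close>

lemma centered_normal_eq_distr:
  assumes "v \<ge> 0"
  shows "centered_normal v = distr std_normal_distribution borel (\<lambda>x. sqrt v * x)"
proof -
  interpret S: real_distribution std_normal_distribution by (rule real_dist_normal_dist)
  show ?thesis
  proof (cases "v = 0")
    case True
    then show ?thesis by (simp add: centered_normal_def)
  next
    case False
    then have v: "v > 0" using assms by simp
    have "distributed std_normal_distribution lborel (\<lambda>x. x) std_normal_density"
      by (simp add: distributed_def distr_id2)
    from S.normal_density_affine[OF this, of "sqrt v" 0] v
    have "distr std_normal_distribution lborel (\<lambda>x. sqrt v * x) = density lborel (normal_density 0 (sqrt v))"
      by (simp add: distributed_def)
    moreover have "distr std_normal_distribution lborel (\<lambda>x. sqrt v * x) = distr std_normal_distribution borel (\<lambda>x. sqrt v * x)"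
      by (rule distr_cong) auto
    ultimately show ?thesis using v by (simp add: centered_normal_def)
  qed
qed

lemma char_scaled_std_normal:
  "char (distr std_normal_distribution borel (\<lambda>x. c * x)) t = complex_of_real (exp (- ((c * t)\<^sup>2) / 2))"
proof -
  have "char (distr std_normal_distribution borel (\<lambda>x. c * x)) t = char std_normal_distribution (c * t)"
    unfolding char_def by (simp add: integral_distr ac_simps)
  then show ?thesis by (simp add: char_std_normal_distribution)
qed

text \<open>By Fubini the characteristic function factors into two Gaussian ones. Levy uniqueness
  identifies the law, also when a coefficient vanishes.\<close>

lemma distr_std_normal_pair_linear:
  "distr (std_normal_distribution \<Otimes>\<^sub>M std_normal_distribution) borel (\<lambda>z. u * fst z + w * snd z) =
   centered_normal (u\<^sup>2 + w\<^sup>2)"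
proof -
  let ?S = "std_normal_distribution"
  interpret S: real_distribution ?S by (rule real_dist_normal_dist)
  interpret P: pair_prob_space ?S ?S ..
  have [measurable]: "(\<lambda>z. u * fst z + w * snd z) \<in> borel_measurable (?S \<Otimes>\<^sub>M ?S)" by measurable
  show ?thesis
    unfolding centered_normal_eq_distr[OF sum_power2_ge_zero]
  proof (rule Levy_uniqueness)
    show "real_distribution (distr (?S \<Otimes>\<^sub>M ?S) borel (\<lambda>z. u * fst z + w * snd z))"
      by (rule P.real_distribution_distr) simp
    show "real_distribution (distr ?S borel (\<lambda>x. sqrt (u\<^sup>2 + w\<^sup>2) * x))"
      by (rule S.real_distribution_distr) simp
    show "char (distr (?S \<Otimes>\<^sub>M ?S) borel (\<lambda>z. u * fst z + w * snd z)) =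
       char (distr ?S borel (\<lambda>x. sqrt (u\<^sup>2 + w\<^sup>2) * x))"
    proof
      fix t
      have int: "integrable (?S \<Otimes>\<^sub>M ?S) (\<lambda>z. iexp (t * u * fst z) * iexp (t * w * snd z))"
        by (rule P.P.integrable_const_bound[of _ 1]) (auto simp: norm_mult)
      have "char (distr (?S \<Otimes>\<^sub>M ?S) borel (\<lambda>z. u * fst z + w * snd z)) t =
        (\<integral>z. iexp (t * u * fst z) * iexp (t * w * snd z) \<partial>(?S \<Otimes>\<^sub>M ?S))"
        unfolding char_def by (simp add: integral_distr exp_add[symmetric] algebra_simps)
      also have "\<dots> = (\<integral>x. (\<integral>y. iexp (t * u * x) * iexp (t * w * y) \<partial>?S) \<partial>?S)"
        using P.integral_fst'[OF int] by simp
      also have "\<dots> = char ?S (t * u) * char ?S (t * w)"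
        unfolding char_def by simp
      also have "\<dots> = complex_of_real (exp (- ((t * u)\<^sup>2) / 2) * exp (- ((t * w)\<^sup>2) / 2))"
        by (simp add: char_std_normal_distribution)
      also have "exp (- ((t * u)\<^sup>2) / 2) * exp (- ((t * w)\<^sup>2) / 2) = exp (- ((sqrt (u\<^sup>2 + w\<^sup>2) * t)\<^sup>2) / 2)"
        by (simp add: exp_add[symmetric] power_mult_distrib) (simp add: field_simps)
      finally show "char (distr (?S \<Otimes>\<^sub>M ?S) borel (\<lambda>z. u * fst z + w * snd z)) t =
         char (distr ?S borel (\<lambda>x. sqrt (u\<^sup>2 + w\<^sup>2) * x)) t"
        by (simp only: char_scaled_std_normal)
    qed
  qed
qed

text \<open>The law is the image of two independent standard normals under a lower triangular map.
  Singular matrices must be included, since for instance \<open>d1\<close> or the variance of the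
  second influence function may be 0.\<close>

lemma bivariate_normal_exists:
  assumes s11: "s11 \<ge> 0" and s22: "s22 \<ge> 0" and det: "s12\<^sup>2 \<le> s11 * s22"
  shows "\<exists>N. bivariate_normal N s11 s12 s22"
proof -
  let ?S = "std_normal_distribution"
  interpret S: real_distribution ?S by (rule real_dist_normal_dist)
  interpret P: pair_prob_space ?S ?S ..
  \<comment> \<open>Cholesky factorisation of the covariance matrix; \<open>\<beta>\<close> is \<open>0\<close> if \<open>s11 = 0\<close>, where \<open>s12 = 0\<close>\<close>
  define \<alpha> where "\<alpha> = sqrt s11"
  define \<beta> where "\<beta> = s12 / \<alpha>"
  define \<gamma> where "\<gamma> = sqrt (s22 - \<beta>\<^sup>2)"
  have a2: "\<alpha>\<^sup>2 = s11" using s11 by (simp add: \<alpha>_def)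
  have ab: "\<alpha> * \<beta> = s12"
  proof (cases "s11 = 0")
    case True
    then show ?thesis using det by (simp add: \<alpha>_def)
  next
    case False
    then show ?thesis by (simp add: \<beta>_def \<alpha>_def)
  qed
  have "\<beta>\<^sup>2 \<le> s22"
  proof (cases "s11 = 0")
    case True
    then show ?thesis using s22 by (simp add: \<beta>_def \<alpha>_def)
  next
    case False
    then have "s11 > 0" using s11 by simp
    then show ?thesis using det by (simp add: \<beta>_def power_divide a2 field_simps)
  qed
  then have g2: "\<gamma>\<^sup>2 = s22 - \<beta>\<^sup>2" by (simp add: \<gamma>_def)
  define T where "T z = (\<alpha> * fst z, \<beta> * fst z + \<gamma> * snd z)" for z :: "real \<times> real"
  have T[measurable]: "T \<in> measurable (?S \<Otimes>\<^sub>M ?S) borel"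
    unfolding T_def borel_prod[symmetric] by measurable
  define N where "N = distr (?S \<Otimes>\<^sub>M ?S) borel T"
  have lin: "(\<lambda>(x, y). a * x + b * y) \<in> borel_measurable (borel :: (real \<times> real) measure)" for a b :: real
    unfolding borel_prod[symmetric] by measurable
  have "distr N borel (\<lambda>(x, y). a * x + b * y) = centered_normal (a\<^sup>2 * s11 + 2 * a * b * s12 + b\<^sup>2 * s22)" for a b
  proof -
    have "distr N borel (\<lambda>(x, y). a * x + b * y) =
        distr (?S \<Otimes>\<^sub>M ?S) borel (\<lambda>z. (a * \<alpha> + b * \<beta>) * fst z + (b * \<gamma>) * snd z)"
      unfolding N_def by (subst distr_distr[OF lin T]) (simp add: comp_def T_def algebra_simps)
    also have "\<dots> = centered_normal ((a * \<alpha> + b * \<beta>)\<^sup>2 + (b * \<gamma>)\<^sup>2)"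
      by (rule distr_std_normal_pair_linear)
    also have "(a * \<alpha> + b * \<beta>)\<^sup>2 + (b * \<gamma>)\<^sup>2 = a\<^sup>2 * \<alpha>\<^sup>2 + 2 * a * b * (\<alpha> * \<beta>) + b\<^sup>2 * (\<beta>\<^sup>2 + \<gamma>\<^sup>2)"
      by (simp add: power2_eq_square algebra_simps)
    also have "\<dots> = a\<^sup>2 * s11 + 2 * a * b * s12 + b\<^sup>2 * s22"
      unfolding a2 ab g2 by simp
    finally show ?thesis .
  qed
  moreover have "prob_space N" unfolding N_def by (rule P.P.prob_space_distr) (rule T)
  ultimately have "bivariate_normal N s11 s12 s22"
    unfolding bivariate_normal_def by (simp add: N_def)
  then show ?thesis by blast
qed

lemma bivariate_normal_linear_moments:
  assumes N: "bivariate_normal N s11 s12 s22"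
  defines "v a b \<equiv> a\<^sup>2 * s11 + 2 * a * b * s12 + b\<^sup>2 * s22"
  shows "v a b \<ge> 0" "integrable N (\<lambda>z. a * fst z + b * snd z)"
    "(\<integral>z. a * fst z + b * snd z \<partial>N) = 0"
    "integrable N (\<lambda>z. (a * fst z + b * snd z)\<^sup>2)"
    "(\<integral>z. (a * fst z + b * snd z)\<^sup>2 \<partial>N) = v a b"
proof -
  have sN: "sets N = sets borel" and pN: "prob_space N"
    and d: "distr N borel (\<lambda>(x, y). a * x + b * y) = centered_normal (v a b)"
    using N by (auto simp: bivariate_normal_def v_def)
  interpret N: prob_space N by (rule pN)
  have m[measurable]: "(\<lambda>z. a * fst z + b * snd z) \<in> borel_measurable N"
    unfolding measurable_cong_sets[OF sN refl] by (intro borel_measurable_continuous_onI continuous_intros)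
  have d: "distr N borel (\<lambda>z. a * fst z + b * snd z) = centered_normal (v a b)"
    using d by (simp add: case_prod_unfold)
  have "prob_space (centered_normal (v a b))"
    unfolding d[symmetric] by (rule N.prob_space_distr) (rule m)
  \<comment> \<open>For negative v the law would be the null measure, whose total mass is 0 and not
    1.\<close>
  then have "emeasure (centered_normal (v a b)) (space (centered_normal (v a b))) = 1"
    by (rule prob_space.emeasure_space_1)
  then show v: "v a b \<ge> 0"
    by (auto simp: centered_normal_def split: if_splits)
  note d = d[unfolded centered_normal_eq_distr[OF v]]
  have mS: "(\<lambda>x. sqrt (v a b) * x) \<in> borel_measurable std_normal_distribution" by measurable
  have i1: "integrable std_normal_distribution (\<lambda>x. sqrt (v a b) * x)"
    "(\<integral>x. sqrt (v a b) * x \<partial>std_normal_distribution) = 0"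
    using integrable_std_normal_distribution_moment[of 1] integral_std_normal_distribution_moment_odd[of 1] by auto
  have i2: "integrable std_normal_distribution (\<lambda>x. (sqrt (v a b) * x)\<^sup>2)"
    "(\<integral>x. (sqrt (v a b) * x)\<^sup>2 \<partial>std_normal_distribution) = v a b"
    using std_normal_distribution_even_moments[of 1] v by (auto simp: power_mult_distrib)
  show "integrable N (\<lambda>z. a * fst z + b * snd z)"
    using integrable_distr_eq[OF m, of "\<lambda>x. x"] integrable_distr_eq[OF mS, of "\<lambda>x. x"] i1 d by simp
  show "(\<integral>z. a * fst z + b * snd z \<partial>N) = 0"
    using integral_distr[OF m, of "\<lambda>x. x"] integral_distr[OF mS, of "\<lambda>x. x"] i1 d by simp
  show "integrable N (\<lambda>z. (a * fst z + b * snd z)\<^sup>2)"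
    using integrable_distr_eq[OF m, of "\<lambda>x. x\<^sup>2"] integrable_distr_eq[OF mS, of "\<lambda>x. x\<^sup>2"] i2 d by simp
  show "(\<integral>z. (a * fst z + b * snd z)\<^sup>2 \<partial>N) = v a b"
    using integral_distr[OF m, of "\<lambda>x. x\<^sup>2"] integral_distr[OF mS, of "\<lambda>x. x\<^sup>2"] i2 d by simp
qed

text \<open>Only laws of linear combinations are known, so the mixed moment is recovered by
  polarisation from the second moments of both coordinates and of their sum.\<close>

lemma correlation2_bivariate_normal:
  assumes N: "bivariate_normal N s11 s12 s22"
  shows "correlation2 N = s12 / sqrt (s11 * s22)"
proof -
  note mom = bivariate_normal_linear_moments[OF N]
  have m1: "(\<integral>z. fst z \<partial>N) = 0" using mom(3)[of 1 0] by simp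
  have m2: "(\<integral>z. snd z \<partial>N) = 0" using mom(3)[of 0 1] by simp
  have i11: "integrable N (\<lambda>z. (fst z)\<^sup>2)" and v11: "(\<integral>z. (fst z)\<^sup>2 \<partial>N) = s11"
    using mom(4,5)[of 1 0] by auto
  have i22: "integrable N (\<lambda>z. (snd z)\<^sup>2)" and v22: "(\<integral>z. (snd z)\<^sup>2 \<partial>N) = s22"
    using mom(4,5)[of 0 1] by auto
  have i3: "integrable N (\<lambda>z. (fst z + snd z)\<^sup>2)" and v3: "(\<integral>z. (fst z + snd z)\<^sup>2 \<partial>N) = s11 + 2 * s12 + s22"
    using mom(4,5)[of 1 1] by auto
  have "(\<integral>z. fst z * snd z \<partial>N) = (\<integral>z. ((fst z + snd z)\<^sup>2 - (fst z)\<^sup>2 - (snd z)\<^sup>2) / 2 \<partial>N)"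
    by (rule Bochner_Integration.integral_cong) (auto simp: power2_eq_square algebra_simps)
  also have "\<dots> = s12"
    using i11 i22 i3 v11 v22 v3 by simp
  finally have "(\<integral>z. fst z * snd z \<partial>N) = s12" .
  then show ?thesis
    unfolding correlation2_def Let_def m1 m2 by (simp add: v11 v22)
qed

section \<open>Normed sums of an iid sample\<close>

text \<open>\<open>X\<close> merely represents the common law. It may depend on the sample in any
  way, since only its distribution enters.\<close>

locale iid_sample = prob_space M for M :: "'a measure" +
  fixes X :: "'a \<Rightarrow> real" and Xs :: "nat \<Rightarrow> 'a \<Rightarrow> real"
  assumes X_measurable [measurable]: "X \<in> borel_measurable M"
    and indep: "indep_vars (\<lambda>_. borel) Xs UNIV"
    and Xs_distr: "\<And>i. distr M borel (Xs i) = distr M borel X"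
begin

lemma Xs_measurable [measurable]: "Xs i \<in> borel_measurable M"
  using indep unfolding indep_vars_def2 by simp

lemma integrable_Xs_iff:
  fixes g :: "real \<Rightarrow> real"
  assumes "g \<in> borel_measurable borel"
  shows "integrable M (\<lambda>\<omega>. g (Xs i \<omega>)) \<longleftrightarrow> integrable M (\<lambda>\<omega>. g (X \<omega>))"
  using integrable_distr_eq[OF Xs_measurable assms] integrable_distr_eq[OF X_measurable assms]
  by (simp add: Xs_distr)

lemma expectation_Xs:
  fixes g :: "real \<Rightarrow> real"
  assumes "g \<in> borel_measurable borel"
  shows "expectation (\<lambda>\<omega>. g (Xs i \<omega>)) = expectation (\<lambda>\<omega>. g (X \<omega>))"
  using integral_distr[OF Xs_measurable assms] integral_distr[OF X_measurable assms]
  by (simp add: Xs_distr)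

lemma indep_compose:
  "g \<in> borel_measurable borel \<Longrightarrow> indep_vars (\<lambda>_. borel) (\<lambda>i \<omega>. g (Xs i \<omega>)) UNIV"
  using indep_vars_compose2[OF indep, of "\<lambda>_. g" "\<lambda>_. borel"] by simp

definition normed_sum :: "(real \<Rightarrow> real) \<Rightarrow> nat \<Rightarrow> 'a \<Rightarrow> real" where
  "normed_sum g n \<omega> = (\<Sum>i<n. g (Xs i \<omega>)) / sqrt (real n)"

lemma normed_sum_measurable [measurable (raw)]:
  assumes [measurable]: "g \<in> borel_measurable borel"
  shows "normed_sum g n \<in> borel_measurable M"
  unfolding normed_sum_def by measurable

text \<open>Induction on n: the new summand is independent of the sum so far and has mean 0, so the
  cross term has mean 0.\<close>

lemma second_moment_sum:
  assumes g[measurable]: "g \<in> borel_measurable borel"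
    and sq: "integrable M (\<lambda>\<omega>. (g (X \<omega>))\<^sup>2)" and mean: "expectation (\<lambda>\<omega>. g (X \<omega>)) = 0"
  shows "integrable M (\<lambda>\<omega>. (\<Sum>i<n. g (Xs i \<omega>))\<^sup>2)"
    and "expectation (\<lambda>\<omega>. (\<Sum>i<n. g (Xs i \<omega>))\<^sup>2) = real n * expectation (\<lambda>\<omega>. (g (X \<omega>))\<^sup>2)"
proof -
  have sqi: "integrable M (\<lambda>\<omega>. (g (Xs i \<omega>))\<^sup>2)"
    "expectation (\<lambda>\<omega>. (g (Xs i \<omega>))\<^sup>2) = expectation (\<lambda>\<omega>. (g (X \<omega>))\<^sup>2)" for i
    using integrable_Xs_iff[of "\<lambda>x. (g x)\<^sup>2" i] expectation_Xs[of "\<lambda>x. (g x)\<^sup>2" i] sq by simp_all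
  have inti: "integrable M (\<lambda>\<omega>. g (Xs i \<omega>))" for i
    by (rule square_integrable_imp_integrable[OF _ sqi(1)]) simp
  have meani: "expectation (\<lambda>\<omega>. g (Xs i \<omega>)) = 0" for i using expectation_Xs[OF g, of i] mean by simp
  have "integrable M (\<lambda>\<omega>. (\<Sum>i<n. g (Xs i \<omega>))\<^sup>2) \<and>
    expectation (\<lambda>\<omega>. (\<Sum>i<n. g (Xs i \<omega>))\<^sup>2) = real n * expectation (\<lambda>\<omega>. (g (X \<omega>))\<^sup>2)"
  proof (induction n)
    case 0
    show ?case by simp
  next
    case (Suc n)
    let ?S = "\<lambda>\<omega>. \<Sum>i<n. g (Xs i \<omega>)" and ?g = "\<lambda>\<omega>. g (Xs n \<omega>)"
    have ind: "indep_var borel ?g borel ?S"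
      by (rule indep_vars_sum) (auto intro: indep_vars_subset[OF indep_compose[OF g]])
    have intS: "integrable M ?S" using inti by simp
    have prod: "integrable M (\<lambda>\<omega>. ?g \<omega> * ?S \<omega>)" "expectation (\<lambda>\<omega>. ?g \<omega> * ?S \<omega>) = 0"
      using indep_var_integrable[OF ind inti intS] indep_var_lebesgue_integral[OF ind inti intS] meani by auto
    have eq: "(\<lambda>\<omega>. (\<Sum>i<Suc n. g (Xs i \<omega>))\<^sup>2) = (\<lambda>\<omega>. (?S \<omega>)\<^sup>2 + 2 * (?g \<omega> * ?S \<omega>) + (?g \<omega>)\<^sup>2)"
      by (auto simp: power2_eq_square algebra_simps)
    show ?case unfolding eq using Suc prod sqi[of n] by (simp add: algebra_simps)
  qed
  then show "integrable M (\<lambda>\<omega>. (\<Sum>i<n. g (Xs i \<omega>))\<^sup>2)"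
    and "expectation (\<lambda>\<omega>. (\<Sum>i<n. g (Xs i \<omega>))\<^sup>2) = real n * expectation (\<lambda>\<omega>. (g (X \<omega>))\<^sup>2)" by auto
qed

text \<open>An inequality so that it holds for every n: at n = 0 the normed sum is 0 by the
  convention for division, and otherwise equality holds.\<close>

lemma second_moment_normed_sum:
  assumes g[measurable]: "g \<in> borel_measurable borel"
    and sq: "integrable M (\<lambda>\<omega>. (g (X \<omega>))\<^sup>2)" and mean: "expectation (\<lambda>\<omega>. g (X \<omega>)) = 0"
  shows "integrable M (\<lambda>\<omega>. (normed_sum g n \<omega>)\<^sup>2)"
    and "expectation (\<lambda>\<omega>. (normed_sum g n \<omega>)\<^sup>2) \<le> expectation (\<lambda>\<omega>. (g (X \<omega>))\<^sup>2)"
proof -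
  have eq: "(\<lambda>\<omega>. (normed_sum g n \<omega>)\<^sup>2) = (\<lambda>\<omega>. (\<Sum>i<n. g (Xs i \<omega>))\<^sup>2 / real n)"
    by (simp add: normed_sum_def power_divide)
  show "integrable M (\<lambda>\<omega>. (normed_sum g n \<omega>)\<^sup>2)"
    unfolding eq using second_moment_sum[OF assms, of n] by simp
  show "expectation (\<lambda>\<omega>. (normed_sum g n \<omega>)\<^sup>2) \<le> expectation (\<lambda>\<omega>. (g (X \<omega>))\<^sup>2)"
    unfolding eq using second_moment_sum[OF assms, of n] by (cases "n = 0") auto
qed

lemma tight_normed_sum:
  assumes "g \<in> borel_measurable borel"
    and "integrable M (\<lambda>\<omega>. (g (X \<omega>))\<^sup>2)" and "expectation (\<lambda>\<omega>. g (X \<omega>)) = 0"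
  shows "tight_in_prob M (normed_sum g)"
  by (rule tight_in_prob_second_moment[OF _ second_moment_normed_sum[OF assms]])
    (use assms in measurable)

lemma weak_law:
  assumes g[measurable]: "g \<in> borel_measurable borel"
    and sq: "integrable M (\<lambda>\<omega>. (g (X \<omega>))\<^sup>2)" and mean: "expectation (\<lambda>\<omega>. g (X \<omega>)) = 0"
  shows "small_in_prob M (\<lambda>n \<omega>. (\<Sum>i<n. g (Xs i \<omega>)) / real n)"
proof (rule small_in_prob_second_moment)
  have eq: "(\<lambda>\<omega>. ((\<Sum>i<n. g (Xs i \<omega>)) / real n)\<^sup>2) = (\<lambda>\<omega>. (\<Sum>i<n. g (Xs i \<omega>))\<^sup>2 / (real n)\<^sup>2)" for n
    by (simp add: power_divide)
  let ?v = "expectation (\<lambda>\<omega>. (g (X \<omega>))\<^sup>2)"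
  show "integrable M (\<lambda>\<omega>. ((\<Sum>i<n. g (Xs i \<omega>)) / real n)\<^sup>2)" for n
    unfolding eq using second_moment_sum[OF assms, of n] by simp
  show "expectation (\<lambda>\<omega>. ((\<Sum>i<n. g (Xs i \<omega>)) / real n)\<^sup>2) \<le> ?v / real n" for n
    unfolding eq using second_moment_sum[OF assms, of n] by (simp add: power2_eq_square)
  show "(\<lambda>n. ?v / real n) \<longlonglongrightarrow> 0" by (rule lim_const_over_n)
qed measurable

text \<open>If the variance v is 0, the normed sum vanishes almost surely. Otherwise the central
  limit theorem applies to the sum divided by sqrt (n v), and the factor sqrt v is put back into the
  argument of the cosine.\<close>

lemma normed_sum_cos_tendsto:
  assumes g[measurable]: "g \<in> borel_measurable borel"
    and sq: "integrable M (\<lambda>\<omega>. (g (X \<omega>))\<^sup>2)" and mean: "expectation (\<lambda>\<omega>. g (X \<omega>)) = 0"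
  shows "(\<lambda>n. expectation (\<lambda>\<omega>. cos (normed_sum g n \<omega> + t))) \<longlonglongrightarrow>
     (\<integral>x. cos (x + t) \<partial>centered_normal (expectation (\<lambda>\<omega>. (g (X \<omega>))\<^sup>2)))"
proof -
  interpret S: real_distribution std_normal_distribution by (rule real_dist_normal_dist)
  define v where "v = expectation (\<lambda>\<omega>. (g (X \<omega>))\<^sup>2)"
  have v0: "v \<ge> 0" by (simp add: v_def)
  have lim: "(\<integral>x. cos (x + t) \<partial>centered_normal v) = (\<integral>x. cos (sqrt v * x + t) \<partial>std_normal_distribution)"
    unfolding centered_normal_eq_distr[OF v0] by (simp add: integral_distr)
  show ?thesis
    unfolding v_def[symmetric] lim
  proof (cases "v = 0")
    case True
    have "expectation (\<lambda>\<omega>. cos (normed_sum g n \<omega> + t)) = cos t" for n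
    proof -
      have "AE \<omega> in M. (normed_sum g n \<omega>)\<^sup>2 = 0"
        using second_moment_normed_sum[OF assms, of n] True unfolding v_def[symmetric]
        by (subst integral_nonneg_eq_0_iff_AE[symmetric]) (auto intro: antisym)
      then have "expectation (\<lambda>\<omega>. cos (normed_sum g n \<omega> + t)) = expectation (\<lambda>\<omega>. cos t)"
        by (intro integral_cong_AE) auto
      then show ?thesis by (simp add: prob_space)
    qed
    moreover have "(\<integral>x. cos (sqrt v * x + t) \<partial>std_normal_distribution) = cos t"
      using True S.prob_space by simp
    ultimately show "(\<lambda>n. expectation (\<lambda>\<omega>. cos (normed_sum g n \<omega> + t))) \<longlonglongrightarrow>
        (\<integral>x. cos (sqrt v * x + t) \<partial>std_normal_distribution)" by simp
  next
    case False
    then have v: "v > 0" using v0 by simp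
    define D where "D n = distr M borel (\<lambda>\<omega>. (\<Sum>i<n. g (Xs i \<omega>)) / sqrt (real n * (sqrt v)\<^sup>2))" for n
    have [measurable]: "(\<lambda>\<omega>. (\<Sum>i<n. g (Xs i \<omega>)) / sqrt (real n * (sqrt v)\<^sup>2)) \<in> borel_measurable M" for n
      by measurable
    have meani: "expectation (\<lambda>\<omega>. g (Xs i \<omega>)) = 0" for i using expectation_Xs[OF g, of i] mean by simp
    have wc: "weak_conv_m D std_normal_distribution"
      unfolding D_def
    proof (rule central_limit_theorem_zero_mean[OF indep_compose[OF g] meani])
      show "integrable M (\<lambda>\<omega>. (g (Xs n \<omega>))\<^sup>2)" for n
        using integrable_Xs_iff[of "\<lambda>x. (g x)\<^sup>2" n] sq by simp
      show "expectation (\<lambda>\<omega>. (g (Xs n \<omega>) - expectation (\<lambda>\<omega>. g (Xs n \<omega>)))\<^sup>2) = (sqrt v)\<^sup>2" for n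
        using expectation_Xs[of "\<lambda>x. (g x)\<^sup>2" n] v by (simp add: meani v_def)
      show "distr M borel (\<lambda>\<omega>. g (Xs n \<omega>)) = distr (distr M borel X) borel g" for n
        unfolding Xs_distr[of n, symmetric] by (subst distr_distr) (auto simp: comp_def)
    qed (use v in auto)
    have "(\<lambda>n. integral\<^sup>L (D n) (\<lambda>x. cos (sqrt v * x + t))) \<longlonglongrightarrow>
        integral\<^sup>L std_normal_distribution (\<lambda>x. cos (sqrt v * x + t))"
      by (rule weak_conv_imp_integral_bdd_continuous_conv[OF _ real_dist_normal_dist wc, of _ 1])
        (auto simp: D_def)
    moreover have "integral\<^sup>L (D n) (\<lambda>x. cos (sqrt v * x + t)) = expectation (\<lambda>\<omega>. cos (normed_sum g n \<omega> + t))" for n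
      unfolding D_def normed_sum_def using v by (simp add: integral_distr real_sqrt_mult)
    ultimately show "(\<lambda>n. expectation (\<lambda>\<omega>. cos (normed_sum g n \<omega> + t))) \<longlonglongrightarrow>
        (\<integral>x. cos (sqrt v * x + t) \<partial>std_normal_distribution)" by simp
  qed
qed

end

text \<open>Slutsky's argument for one test function: the cosine is 1-Lipschitz, which handles |R|
  \<le> e/2, and two of its values differ by at most 2, which handles the event |R| > e/2 of
  probability below e/4.\<close>

lemma (in prob_space) cos_tendsto_add_small:
  fixes S R :: "nat \<Rightarrow> 'a \<Rightarrow> real"
  assumes S[measurable]: "\<And>n. S n \<in> borel_measurable M" and R: "small_in_prob M R"
    and cv: "(\<lambda>n. expectation (\<lambda>\<omega>. cos (S n \<omega> + t))) \<longlonglongrightarrow> l"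
  shows "(\<lambda>n. expectation (\<lambda>\<omega>. cos (S n \<omega> + R n \<omega> + t))) \<longlonglongrightarrow> l"
proof -
  note [measurable] = small_in_prob_measurable[OF R]
  have int: "integrable M (\<lambda>\<omega>. cos (f \<omega>))" if [measurable]: "f \<in> borel_measurable M" for f :: "'a \<Rightarrow> real"
    by (rule integrable_const_bound[of _ 1]) auto
  have "(\<lambda>n. expectation (\<lambda>\<omega>. cos (S n \<omega> + R n \<omega> + t)) - expectation (\<lambda>\<omega>. cos (S n \<omega> + t))) \<longlonglongrightarrow> 0"
  proof (rule LIMSEQ_I)
    fix e :: real assume e: "e > 0"
    have "eventually (\<lambda>n. prob {\<omega> \<in> space M. e/2 < \<bar>R n \<omega>\<bar>} < e/4) sequentially"
      by (rule small_in_probD[OF R]) (use e in auto)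
    then have "eventually (\<lambda>n. norm (expectation (\<lambda>\<omega>. cos (S n \<omega> + R n \<omega> + t)) - expectation (\<lambda>\<omega>. cos (S n \<omega> + t)) - 0) < e) sequentially"
    proof eventually_elim
      case (elim n)
      have "\<bar>expectation (\<lambda>\<omega>. cos (S n \<omega> + R n \<omega> + t)) - expectation (\<lambda>\<omega>. cos (S n \<omega> + t))\<bar>
         \<le> e/2 + 2 * prob {\<omega> \<in> space M. e/2 < \<bar>R n \<omega>\<bar>}"
      proof (rule expectation_diff_le)
        fix \<omega> assume \<omega>: "\<omega> \<in> space M"
        have "\<bar>cos a - cos b\<bar> \<le> \<bar>a - b\<bar>" for a b :: real
        proof -
          have "\<bar>cos a - cos b\<bar> = 2 * (\<bar>sin ((a + b) / 2)\<bar> * \<bar>sin ((b - a) / 2)\<bar>)"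
            by (simp add: cos_diff_cos abs_mult)
          also have "\<dots> \<le> 2 * (1 * \<bar>(b - a) / 2\<bar>)"
            by (intro mult_left_mono mult_mono abs_sin_x_le_abs_x) auto
          finally show ?thesis by simp
        qed
        from this[of "S n \<omega> + R n \<omega> + t" "S n \<omega> + t"]
        have "\<bar>cos (S n \<omega> + R n \<omega> + t) - cos (S n \<omega> + t)\<bar> \<le> \<bar>R n \<omega>\<bar>" by simp
        moreover have "\<bar>cos (S n \<omega> + R n \<omega> + t) - cos (S n \<omega> + t)\<bar> \<le> 2"
          using abs_cos_le_one[of "S n \<omega> + R n \<omega> + t"] abs_cos_le_one[of "S n \<omega> + t"] by linarith
        ultimately show "\<bar>cos (S n \<omega> + R n \<omega> + t) - cos (S n \<omega> + t)\<bar> \<le>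
          e/2 + 2 * indicator {\<omega> \<in> space M. e/2 < \<bar>R n \<omega>\<bar>} \<omega>"
          using \<omega> e by (auto simp: indicator_def)
      qed (use int in auto)
      with elim e show ?case by auto
    qed
    then show "\<exists>no. \<forall>n\<ge>no. norm (expectation (\<lambda>\<omega>. cos (S n \<omega> + R n \<omega> + t)) - expectation (\<lambda>\<omega>. cos (S n \<omega> + t)) - 0) < e"
      by (simp add: eventually_sequentially)
  qed
  from tendsto_add[OF this cv] show ?thesis by simp
qed

section \<open>Sample quantiles\<close>

text \<open>In a sorted list the entries at most x form an initial segment, so an index belongs to
  it exactly if it is below its length.\<close>

lemma sorted_nth_le_iff_filter:
  fixes ys :: "'a::linorder list"
  assumes "sorted ys" "k < length ys"
  shows "ys ! k \<le> x \<longleftrightarrow> k < length (filter (\<lambda>y. y \<le> x) ys)"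
  using assms
proof (induction ys arbitrary: k)
  case (Cons y ys)
  show ?case
  proof (cases "y \<le> x")
    case True
    then show ?thesis using Cons by (cases k) auto
  next
    case False
    have "\<forall>z\<in>set (y # ys). \<not> z \<le> x" using False Cons.prems(1) by auto
    moreover have "(y # ys) ! k \<in> set (y # ys)" using Cons.prems(2) by (rule nth_mem)
    ultimately have "\<not> (y # ys) ! k \<le> x" "filter (\<lambda>y. y \<le> x) (y # ys) = []"
      unfolding filter_empty_conv by blast+
    then show ?thesis by simp
  qed
qed simp

lemma order_stat_le_iff:
  assumes "1 \<le> k" "k \<le> length xs"
  shows "order_stat xs k \<le> x \<longleftrightarrow> k \<le> length (filter (\<lambda>y. y \<le> x) xs)"
proof -
  have "length (filter (\<lambda>y. y \<le> x) (sort xs)) = length (filter (\<lambda>y. y \<le> x) xs)"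
    by (metis mset_filter mset_sort size_mset)
  then show ?thesis
    using sorted_nth_le_iff_filter[of "sort xs" "k - 1" x] assms by (auto simp: order_stat_def)
qed

text \<open>The bridge from order statistics to the empirical distribution function. The ceiling
  disappears because a count is an integer, and 0 < p < 1 keeps the index between 1 and n.\<close>

lemma sample_quantile_le_iff:
  assumes "n \<ge> 1" "0 < p" "p < 1"
  shows "sample_quantile Xs n p \<omega> \<le> x \<longleftrightarrow> real n * p \<le> (\<Sum>i<n. indicator {..x} (Xs i \<omega>))"
proof -
  let ?k = "nat \<lceil>real n * p\<rceil>"
  have "real n * p > 0" using assms by simp
  then have k1: "1 \<le> ?k" by linarith
  have "real n * p \<le> real n" using assms by (simp add: mult_left_le)
  then have k2: "?k \<le> n" by linarith
  have "real (length (filter (\<lambda>y. y \<le> x) (map (\<lambda>i. Xs i \<omega>) [0..<n]))) = (\<Sum>i<n. indicator {..x} (Xs i \<omega>))"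
  proof -
    have "real (length (filter (\<lambda>y. y \<le> x) (map (\<lambda>i. Xs i \<omega>) [0..<m]))) = (\<Sum>i<m. indicator {..x} (Xs i \<omega>))" for m
      by (induction m) (auto simp: indicator_def)
    then show ?thesis .
  qed
  moreover have "?k \<le> j \<longleftrightarrow> real n * p \<le> real j" for j by linarith
  ultimately show ?thesis
    unfolding sample_quantile_def using order_stat_le_iff[OF k1, of "map (\<lambda>i. Xs i \<omega>) [0..<n]" x] k2 by simp
qed

lemma cdf_rv_eq: "X \<in> borel_measurable M \<Longrightarrow> cdf_rv M X = cdf (distr M borel X)"
  by (auto simp: cdf_rv_def cdf_def fun_eq_iff measure_distr vimage_def Int_def intro!: arg_cong[where f="measure M"])

text \<open>If F q were below p, continuity would keep F below p up to some q + d/2 and push the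
  infimum beyond q. If F q were above p, some point left of q would belong to the set.\<close>

lemma (in prob_space) cdf_rv_quantile_rv:
  assumes X: "X \<in> borel_measurable M" and p: "0 < p" "p < 1"
    and cont: "isCont (cdf_rv M X) (quantile_rv M X p)"
  shows "cdf_rv M X (quantile_rv M X p) = p"
proof -
  interpret D: real_distribution "distr M borel X" using X by (rule real_distribution_distr)
  define F where "F = cdf_rv M X"
  define q where "q = quantile_rv M X p"
  have F: "F = cdf (distr M borel X)" unfolding F_def by (rule cdf_rv_eq[OF X])
  have mono: "x \<le> y \<Longrightarrow> F x \<le> F y" for x y unfolding F by (rule D.cdf_nondecreasing)
  have q: "q = Inf {x. p \<le> F x}" by (simp add: q_def F_def quantile_rv_def)
  \<comment> \<open>The two tail limits make the set nonempty and bounded below, so that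
    \<open>Inf\<close> is a genuine infimum.\<close>
  have "eventually (\<lambda>x. F x > p) at_top" using D.cdf_lim_at_top_prob p unfolding F by (intro order_tendstoD) auto
  then obtain b where b: "F b > p" by (meson eventually_at_top_linorder order_refl)
  have "eventually (\<lambda>x. F x < p) at_bot" using D.cdf_lim_at_bot p unfolding F by (intro order_tendstoD) auto
  then obtain a where a: "F a < p" by (meson eventually_at_bot_linorder order_refl)
  have bdd: "bdd_below {x. p \<le> F x}"
  proof (rule bdd_belowI[of _ a])
    fix x assume "x \<in> {x. p \<le> F x}"
    then show "a \<le> x" using a mono[of x a] by (cases "a \<le> x") auto
  qed
  have c: "(F \<longlongrightarrow> F q) (at q)" using cont by (simp add: isCont_def F_def q_def)
  have "\<not> F q < p"
  proof
    assume lt: "F q < p"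
    then have "eventually (\<lambda>x. F x < p) (at q)" using c by (intro order_tendstoD) auto
    then obtain d where d: "d > 0" "\<And>x. x \<noteq> q \<Longrightarrow> dist x q < d \<Longrightarrow> F x < p"
      by (auto simp: eventually_at)
    have "F (q + d/2) < p" using d by (intro d(2)) (auto simp: dist_real_def)
    then have "q + d/2 \<le> x" if "p \<le> F x" for x
      using mono[of x "q + d/2"] that by linarith
    then have "q + d/2 \<le> q" unfolding q by (intro cInf_greatest) (use b in \<open>auto intro: less_imp_le\<close>)
    then show False using d by simp
  qed
  moreover have "\<not> p < F q"
  proof
    assume lt: "p < F q"
    then have "eventually (\<lambda>x. p < F x) (at q)" using c by (intro order_tendstoD) auto
    then obtain d where d: "d > 0" "\<And>x. x \<noteq> q \<Longrightarrow> dist x q < d \<Longrightarrow> p < F x"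
      by (auto simp: eventually_at)
    have "p < F (q - d/2)" using d by (intro d(2)) (auto simp: dist_real_def)
    then have "q \<le> q - d/2" unfolding q by (intro cInf_lower bdd) auto
    then show False using d by simp
  qed
  ultimately show ?thesis unfolding F_def q_def by linarith
qed

context iid_sample
begin

lemma sample_quantile_measurable:
  assumes p: "0 < p" "p < 1"
  shows "sample_quantile Xs n p \<in> borel_measurable M"
proof (cases "n = 0")
  \<comment> \<open>For n = 0 the statistic is the unspecified value \<open>[] ! 0\<close>, which is
    a constant.\<close>
  case True
  then show ?thesis by (simp add: sample_quantile_def[abs_def])
next
  case False
  then have "n \<ge> 1" by simp
  have "{\<omega> \<in> space M. sample_quantile Xs n p \<omega> \<le> x} \<in> events" for x
    unfolding sample_quantile_le_iff[OF \<open>n \<ge> 1\<close> p] by measurable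
  then show ?thesis by (simp add: borel_measurable_iff_le)
qed

lemma expectation_indicator_X:
  "A \<in> sets borel \<Longrightarrow> expectation (\<lambda>\<omega>. indicator A (X \<omega>)) = prob {\<omega> \<in> space M. X \<omega> \<in> A}"
  by (subst Bochner_Integration.integral_cong[OF refl, of _ _ "indicator {\<omega> \<in> space M. X \<omega> \<in> A}"])
    (auto simp: indicator_def)

text \<open>For each fixed t, the event that the scaled quantile deviation is at most t coincides
  with the event that the normed sum plus a small error is at most a threshold tending to t. This is
  the input of \<open>small_in_prob_diff_ghosh\<close>; tightness of the quantile deviation is then
  inherited from the normed sum.\<close>

lemma sample_quantile_representation:
  assumes p: "0 < p" "p < 1"
    and F': "(cdf_rv M X has_real_derivative fq) (at (quantile_rv M X p))" and fq: "fq > 0"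
  defines "q \<equiv> quantile_rv M X p"
  shows "small_in_prob M (\<lambda>n \<omega>. sqrt (real n) * (sample_quantile Xs n p \<omega> - q)
            - normed_sum (\<lambda>x. (p - indicator {..q} x) / fq) n \<omega>)" (is ?small)
    and "tight_in_prob M (\<lambda>n \<omega>. sqrt (real n) * (sample_quantile Xs n p \<omega> - q))" (is ?tight)
proof -
  define F where "F = cdf_rv M X"
  note [measurable] = sample_quantile_measurable[OF p]
  have cont: "isCont F q" using F' unfolding F_def q_def by (rule DERIV_isCont)
  have Fq: "F q = p" using cdf_rv_quantile_rv[OF X_measurable p] cont by (simp add: F_def q_def)
  have E1: "expectation (\<lambda>\<omega>. indicator {..x} (X \<omega>)) = F x" for x
    by (subst expectation_indicator_X) (auto simp: F_def cdf_rv_def)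
  have intI: "integrable M (\<lambda>\<omega>. indicator {..x} (X \<omega>) :: real)" for x
    by (rule integrable_const_bound[of _ 1]) (auto simp: indicator_def)
  define V where "V n \<omega> = sqrt (real n) * (sample_quantile Xs n p \<omega> - q)" for n \<omega>
  define w where "w x = (p - indicator {..q} x) / fq" for x :: real
  have w_m[measurable]: "w \<in> borel_measurable borel" unfolding w_def by measurable
  have "\<bar>w x\<bar> \<le> \<bar>1 / fq\<bar>" for x
    using fq p by (auto simp: w_def indicator_def field_simps abs_if)
  then have "(w x)\<^sup>2 \<le> (1 / fq)\<^sup>2" for x by (simp only: abs_le_square_iff)
  then have w_sq: "integrable M (\<lambda>\<omega>. (w (X \<omega>))\<^sup>2)"
    by (intro integrable_const_bound[of _ "(1 / fq)\<^sup>2"]) auto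
  have w_mean: "expectation (\<lambda>\<omega>. w (X \<omega>)) = 0"
    unfolding w_def using intI[of q] by (simp add: E1 Fq prob_space)
  have V_m[measurable]: "V n \<in> borel_measurable M" for n unfolding V_def by measurable
  have tW: "tight_in_prob M (normed_sum w)" by (rule tight_normed_sum[OF w_m w_sq w_mean])
  have key: "\<exists>D \<tau>. small_in_prob M D \<and> \<tau> \<longlonglongrightarrow> t \<and>
      (\<forall>n\<ge>1. \<forall>\<omega>. V n \<omega> \<le> t \<longleftrightarrow> normed_sum w n \<omega> + D n \<omega> \<le> \<tau> n)" for t
  proof -
    define x where "x n = q + t / sqrt (real n)" for n
    \<comment> \<open>Adding \<open>g n\<close> to \<open>w\<close> moves the indicator from level q
      to level \<open>x n\<close>: the sum is the centred indicator of {..x n}, with sign reversed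
      and divided by \<open>fq\<close>. The threshold \<tau> is the scaled increment of F between
      the two levels.\<close>
    define g where "g n y = (F (x n) - indicator {..x n} y - (p - indicator {..q} y)) / fq" for n y
    define \<tau> where "\<tau> n = sqrt (real n) * (F (x n) - p) / fq" for n
    have tq: "(\<lambda>n. t / sqrt (real n)) \<longlonglongrightarrow> 0"
      using filterlim_compose[OF sqrt_at_top filterlim_real_sequentially]
      by (intro tendsto_divide_0[OF tendsto_const]) (rule filterlim_at_top_imp_at_infinity)
    have xq: "x \<longlonglongrightarrow> q" unfolding x_def using tendsto_add[OF tendsto_const tq, of q] by simp
    have Fx: "(\<lambda>n. F (x n)) \<longlonglongrightarrow> p" using isCont_tendsto_compose[OF cont xq] by (simp add: Fq)
    have g_m[measurable]: "g n \<in> borel_measurable borel" for n unfolding g_def by measurable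
    have g_mean: "expectation (\<lambda>\<omega>. g n (X \<omega>)) = 0" for n
      unfolding g_def using intI by (simp add: E1 Fq prob_space)
    \<comment> \<open>The difference takes only the values -1, 0 and 1, so its second moment equals
      its mean absolute value, the probability of the interval between q and
      \<open>x n\<close>.\<close>
    have ind_sq: "(indicator {..q} y - indicator {..x n} y :: real)\<^sup>2 =
        \<bar>indicator {..q} y - indicator {..x n} y\<bar>" for y n
      by (auto simp: indicator_def)
    have abs_eq: "expectation (\<lambda>\<omega>. \<bar>indicator {..q} (X \<omega>) - indicator {..x n} (X \<omega>)\<bar>) = \<bar>F (x n) - p\<bar>" for n
    proof (cases "q \<le> x n")
      case True
      then have "(\<lambda>\<omega>. \<bar>indicator {..q} (X \<omega>) - indicator {..x n} (X \<omega>) :: real\<bar>) =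
        (\<lambda>\<omega>. indicator {..x n} (X \<omega>) - indicator {..q} (X \<omega>))" by (auto simp: indicator_def fun_eq_iff)
      then have "expectation (\<lambda>\<omega>. \<bar>indicator {..q} (X \<omega>) - indicator {..x n} (X \<omega>)\<bar>) = F (x n) - p"
        using intI by (simp add: E1 Fq)
      moreover have "0 \<le> expectation (\<lambda>\<omega>. \<bar>indicator {..q} (X \<omega>) - indicator {..x n} (X \<omega>) :: real\<bar>)" by simp
      ultimately show ?thesis by simp
    next
      case False
      then have "(\<lambda>\<omega>. \<bar>indicator {..q} (X \<omega>) - indicator {..x n} (X \<omega>) :: real\<bar>) =
        (\<lambda>\<omega>. indicator {..q} (X \<omega>) - indicator {..x n} (X \<omega>))" by (auto simp: indicator_def fun_eq_iff)
      then have "expectation (\<lambda>\<omega>. \<bar>indicator {..q} (X \<omega>) - indicator {..x n} (X \<omega>)\<bar>) = p - F (x n)"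
        using intI by (simp add: E1 Fq)
      moreover have "0 \<le> expectation (\<lambda>\<omega>. \<bar>indicator {..q} (X \<omega>) - indicator {..x n} (X \<omega>) :: real\<bar>)" by simp
      ultimately show ?thesis by simp
    qed
    have int2: "integrable M (\<lambda>\<omega>. \<bar>indicator {..q} (X \<omega>) - indicator {..x n} (X \<omega>) :: real\<bar>)" for n
      using intI by simp
    have g_sq: "integrable M (\<lambda>\<omega>. (g n (X \<omega>))\<^sup>2)"
      and g_var: "expectation (\<lambda>\<omega>. (g n (X \<omega>))\<^sup>2) \<le> \<bar>F (x n) - p\<bar> / fq\<^sup>2" for n
    proof -
      let ?A = "\<lambda>\<omega>. indicator {..q} (X \<omega>) - indicator {..x n} (X \<omega>) :: real"
      let ?m = "F (x n) - p"
      have eq: "(\<lambda>\<omega>. (g n (X \<omega>))\<^sup>2) = (\<lambda>\<omega>. (\<bar>?A \<omega>\<bar> + 2 * ?m * ?A \<omega> + ?m\<^sup>2) / fq\<^sup>2)"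
      proof
        fix \<omega>
        have "g n (X \<omega>) = (?A \<omega> + ?m) / fq" by (simp add: g_def)
        then have "(g n (X \<omega>))\<^sup>2 = ((?A \<omega>)\<^sup>2 + 2 * ?m * ?A \<omega> + ?m\<^sup>2) / fq\<^sup>2"
          by (simp only: power_divide power2_sum) (simp add: algebra_simps)
        then show "(g n (X \<omega>))\<^sup>2 = (\<bar>?A \<omega>\<bar> + 2 * ?m * ?A \<omega> + ?m\<^sup>2) / fq\<^sup>2" by (simp only: ind_sq)
      qed
      have intA: "integrable M ?A" "expectation ?A = - ?m" using intI by (simp_all add: E1 Fq)
      show "integrable M (\<lambda>\<omega>. (g n (X \<omega>))\<^sup>2)"
        unfolding eq using int2[of n] intA by (intro integrable_divide integrable_add integrable_mult_right) auto
      have expand: "expectation (\<lambda>\<omega>. u \<omega> + 2 * b * v \<omega> + b\<^sup>2) = expectation u + 2 * b * expectation v + b\<^sup>2"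
        if "integrable M u" "integrable M v" for u v and b :: real
        using that by (simp add: prob_space)
      have "expectation (\<lambda>\<omega>. \<bar>?A \<omega>\<bar> + 2 * ?m * ?A \<omega> + ?m\<^sup>2) =
          expectation (\<lambda>\<omega>. \<bar>?A \<omega>\<bar>) + 2 * ?m * expectation ?A + ?m\<^sup>2"
        using expand[OF int2[of n] intA(1)] .
      \<comment> \<open>The three terms are |m|, - 2 m^2 and m^2, with m the increment of F.\<close>
      also have "\<dots> \<le> \<bar>?m\<bar>" unfolding abs_eq intA(2) using zero_le_power2[of ?m] by (simp add: power2_eq_square algebra_simps)
      finally show "expectation (\<lambda>\<omega>. (g n (X \<omega>))\<^sup>2) \<le> \<bar>F (x n) - p\<bar> / fq\<^sup>2"
        unfolding eq integral_divide_zero by (intro divide_right_mono) auto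
    qed
    have "small_in_prob M (\<lambda>n. normed_sum (g n) n)"
    proof (rule small_in_prob_second_moment)
      show "expectation (\<lambda>\<omega>. (normed_sum (g n) n \<omega>)\<^sup>2) \<le> \<bar>F (x n) - p\<bar> / fq\<^sup>2" for n
        using second_moment_normed_sum(2)[OF g_m g_sq g_mean] g_var order_trans by blast
      have "(\<lambda>n. \<bar>F (x n) - p\<bar> / fq\<^sup>2) \<longlonglongrightarrow> \<bar>p - p\<bar> / fq\<^sup>2"
        using fq by (intro tendsto_intros Fx) auto
      then show "(\<lambda>n. \<bar>F (x n) - p\<bar> / fq\<^sup>2) \<longlonglongrightarrow> 0" by simp
    qed (auto intro: second_moment_normed_sum(1)[OF g_m g_sq g_mean])
    moreover have "\<tau> \<longlonglongrightarrow> t"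
    \<comment> \<open>The difference quotient has t / sqrt n in its denominator, so t = 0 is treated
      apart; there \<tau> vanishes identically.\<close>
    proof (cases "t = 0")
      case True
      then show ?thesis by (simp add: \<tau>_def[abs_def] x_def Fq)
    next
      case False
      have "((\<lambda>h. (F (q + h) - F q) / h) \<longlongrightarrow> fq) (at 0)"
        using F' unfolding F_def q_def by (simp add: DERIV_def)
      moreover have "filterlim (\<lambda>n. t / sqrt (real n)) (at 0) sequentially"
        unfolding filterlim_at using tq False
        by (auto intro: eventually_mono[OF eventually_gt_at_top[of 0]])
      ultimately have "(\<lambda>n. (F (q + t / sqrt (real n)) - F q) / (t / sqrt (real n))) \<longlonglongrightarrow> fq"
        by (rule filterlim_compose)
      then have "(\<lambda>n. t / fq * ((F (q + t / sqrt (real n)) - F q) / (t / sqrt (real n)))) \<longlonglongrightarrow> t / fq * fq"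
        by (intro tendsto_intros)
      moreover have "(\<lambda>n. t / fq * ((F (q + t / sqrt (real n)) - F q) / (t / sqrt (real n)))) = \<tau>"
        using False by (simp add: fun_eq_iff \<tau>_def x_def Fq)
      ultimately show ?thesis using fq by simp
    qed
    moreover have "V n \<omega> \<le> t \<longleftrightarrow> normed_sum w n \<omega> + normed_sum (g n) n \<omega> \<le> \<tau> n" if n: "n \<ge> 1" for n \<omega>
    proof -
      let ?c = "\<Sum>i<n. indicator {..x n} (Xs i \<omega>) :: real"
      have n0: "sqrt (real n) > 0" using n by simp
      have "V n \<omega> \<le> t \<longleftrightarrow> sample_quantile Xs n p \<omega> \<le> x n"
        unfolding V_def x_def using n0 by (simp add: field_simps)
      also have "\<dots> \<longleftrightarrow> real n * p \<le> ?c" by (rule sample_quantile_le_iff[OF n p])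
      \<comment> \<open>Both sides are subtracted from n F(x n), which turns the inequality round,
        and divided by the positive number fq sqrt n.\<close>
      also have "\<dots> \<longleftrightarrow> (real n * F (x n) - ?c) / (fq * sqrt (real n)) \<le> real n * (F (x n) - p) / (fq * sqrt (real n))"
      proof -
        have "a / k \<le> b / k \<longleftrightarrow> a \<le> b" if "k > 0" for a b k :: real
          using that by (simp add: divide_le_cancel)
        from this[of "fq * sqrt (real n)"] show ?thesis using n0 fq by (simp add: algebra_simps)
      qed
      also have "real n * (F (x n) - p) / (fq * sqrt (real n)) = \<tau> n"
        unfolding \<tau>_def using n0 fq by (simp add: field_simps)
      also have "(real n * F (x n) - ?c) / (fq * sqrt (real n)) = normed_sum w n \<omega> + normed_sum (g n) n \<omega>"
      proof -
        have "normed_sum w n \<omega> + normed_sum (g n) n \<omega> = (\<Sum>i<n. w (Xs i \<omega>) + g n (Xs i \<omega>)) / sqrt (real n)"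
          by (simp add: normed_sum_def sum.distrib add_divide_distrib)
        also have "(\<Sum>i<n. w (Xs i \<omega>) + g n (Xs i \<omega>)) = (\<Sum>i<n. (F (x n) - indicator {..x n} (Xs i \<omega>)) / fq)"
          by (rule sum.cong) (auto simp: w_def g_def add_divide_distrib[symmetric])
        also have "\<dots> = (real n * F (x n) - ?c) / fq"
          by (simp add: sum_divide_distrib[symmetric] sum_subtractf)
        finally show ?thesis by simp
      qed
      finally show ?thesis .
    qed
    ultimately show ?thesis by blast
  qed
  have V_W: "small_in_prob M (\<lambda>n \<omega>. V n \<omega> - normed_sum w n \<omega>)"
  proof (rule small_in_prob_diff_ghosh[OF V_m tW])
    fix t e :: real assume e: "e > 0"
    obtain D \<tau> where D: "small_in_prob M D" "\<tau> \<longlonglongrightarrow> t"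
      "\<And>n \<omega>. n \<ge> 1 \<Longrightarrow> V n \<omega> \<le> t \<longleftrightarrow> normed_sum w n \<omega> + D n \<omega> \<le> \<tau> n" using key[of t] by blast
    note [measurable] = small_in_prob_measurable[OF D(1)]
    \<comment> \<open>On the event the normed sum is at least t + e, while together with the error
      it is at most \<tau> n < t + e/2. The error is therefore below - e/2.\<close>
    have "eventually (\<lambda>n. \<tau> n < t + e/2) sequentially" using D(2) e by (intro order_tendstoD) auto
    then have ev: "eventually (\<lambda>n. prob {\<omega> \<in> space M. V n \<omega> \<le> t \<and> normed_sum w n \<omega> \<ge> t + e}
        \<le> prob {\<omega> \<in> space M. e/2 < \<bar>D n \<omega>\<bar>}) sequentially"
      using eventually_ge_at_top[of 1]
    proof eventually_elim
      case (elim n)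
      have "{\<omega> \<in> space M. V n \<omega> \<le> t \<and> normed_sum w n \<omega> \<ge> t + e} \<subseteq> {\<omega> \<in> space M. e/2 < \<bar>D n \<omega>\<bar>}"
        using D(3)[OF elim(2)] elim(1) by fastforce
      then show ?case by (rule finite_measure_mono) measurable
    qed
    have lim: "(\<lambda>n. prob {\<omega> \<in> space M. e/2 < \<bar>D n \<omega>\<bar>}) \<longlonglongrightarrow> 0"
      by (rule small_in_prob_tendsto[OF D(1)]) (use e in simp)
    show "(\<lambda>n. prob {\<omega> \<in> space M. V n \<omega> \<le> t \<and> normed_sum w n \<omega> \<ge> t + e}) \<longlonglongrightarrow> 0"
      by (rule tendsto_sandwich[rotated, OF ev tendsto_const lim]) simp
  next
    fix t e :: real assume e: "e > 0"
    \<comment> \<open>The equivalence speaks of events V \<le> level, and V \<ge> t + e contradicts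
      such an event only for a level strictly below t + e. The midpoint t + e/2 leaves room on both
      sides.\<close>
    obtain D \<tau> where D: "small_in_prob M D" "\<tau> \<longlonglongrightarrow> t + e/2"
      "\<And>n \<omega>. n \<ge> 1 \<Longrightarrow> V n \<omega> \<le> t + e/2 \<longleftrightarrow> normed_sum w n \<omega> + D n \<omega> \<le> \<tau> n" using key[of "t + e/2"] by blast
    note [measurable] = small_in_prob_measurable[OF D(1)]
    have "eventually (\<lambda>n. \<tau> n > t + e/4) sequentially" using D(2) e by (intro order_tendstoD) auto
    then have ev: "eventually (\<lambda>n. prob {\<omega> \<in> space M. V n \<omega> \<ge> t + e \<and> normed_sum w n \<omega> \<le> t}
        \<le> prob {\<omega> \<in> space M. e/4 < \<bar>D n \<omega>\<bar>}) sequentially"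
      using eventually_ge_at_top[of 1]
    proof eventually_elim
      case (elim n)
      have "e/4 < \<bar>D n \<omega>\<bar>" if "V n \<omega> \<ge> t + e" "normed_sum w n \<omega> \<le> t" for \<omega>
      proof -
        have "\<not> V n \<omega> \<le> t + e/2" using that e by simp
        then show ?thesis using D(3)[OF elim(2), of \<omega>] elim(1) that by linarith
      qed
      then have "{\<omega> \<in> space M. V n \<omega> \<ge> t + e \<and> normed_sum w n \<omega> \<le> t} \<subseteq> {\<omega> \<in> space M. e/4 < \<bar>D n \<omega>\<bar>}"
        by blast
      then show ?case by (rule finite_measure_mono) measurable
    qed
    have lim: "(\<lambda>n. prob {\<omega> \<in> space M. e/4 < \<bar>D n \<omega>\<bar>}) \<longlonglongrightarrow> 0"
      by (rule small_in_prob_tendsto[OF D(1)]) (use e in simp)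
    show "(\<lambda>n. prob {\<omega> \<in> space M. V n \<omega> \<ge> t + e \<and> normed_sum w n \<omega> \<le> t}) \<longlonglongrightarrow> 0"
      by (rule tendsto_sandwich[rotated, OF ev tendsto_const lim]) simp
  qed
  then show ?small unfolding V_def w_def .
  show ?tight using tight_in_prob_add_small[OF tW V_W] by (simp add: V_def)
qed

end

section \<open>Sample absolute central moments\<close>

text \<open>Up to the factor r this is the derivative of |y|^r where it exists, written in the form
  in which it enters c_r.\<close>

definition signed_power :: "nat \<Rightarrow> real \<Rightarrow> real" where
  "signed_power r y = y ^ (r - 1) * (sgn y) ^ r"

text \<open>The powers of the sign collect to an odd power, (sgn y)^(2 r - 1), which is sgn y. For r
  = 0 the truncated exponent r - 1 would break this.\<close>

lemma signed_power_eq: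
  assumes "r \<ge> 1" shows "signed_power r y = \<bar>y\<bar> ^ (r - 1) * sgn y"
proof (cases "y \<ge> 0")
  case True
  then show ?thesis using assms by (cases "y = 0") (auto simp: signed_power_def sgn_if)
next
  case False
  obtain k where r: "r = Suc k" using assms by (cases r) auto
  have "y ^ k * (- 1) ^ k = (- y) ^ k" by (metis mult.commute mult_minus1 power_mult_distrib)
  then show ?thesis using False by (simp add: signed_power_def sgn_if r)
qed

lemma mono_signed_power:
  assumes "r \<ge> 1" "x \<le> y" shows "signed_power r x \<le> signed_power r y"
proof -
  consider "0 \<le> x" | "x < 0" "0 \<le> y" | "y < 0" using assms by linarith
  then show ?thesis
  proof cases
    case 1
    have "\<bar>x\<bar> ^ (r - 1) * sgn x \<le> \<bar>y\<bar> ^ (r - 1) * sgn y"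
      using 1 assms by (intro mult_mono power_mono) (auto simp: sgn_if)
    then show ?thesis using assms by (simp add: signed_power_eq)
  next
    case 2
    have "\<bar>x\<bar> ^ (r - 1) * sgn x \<le> 0" "0 \<le> \<bar>y\<bar> ^ (r - 1) * sgn y"
      using 2 by (auto simp: sgn_if)
    then show ?thesis using assms by (simp add: signed_power_eq)
  next
    case 3
    have "\<bar>y\<bar> ^ (r - 1) \<le> \<bar>x\<bar> ^ (r - 1)" using 3 assms by (intro power_mono) auto
    then show ?thesis using assms 3 by (simp add: signed_power_eq sgn_if)
  qed
qed

lemma abs_signed_power_le: "r \<ge> 1 \<Longrightarrow> \<bar>signed_power r y\<bar> \<le> \<bar>y\<bar> ^ (r - 1)"
  by (auto simp: signed_power_eq abs_mult sgn_if power_abs)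

text \<open>At 0 the function is squeezed by |y|^(r - 1), which tends to 0 exactly when r \<ge> 2.
  For r = 1 it is sgn with its jump, which is why that case has to exclude an atom at the
  mean.\<close>

lemma isCont_signed_power:
  assumes "r \<ge> 1" "r \<ge> 2 \<or> y \<noteq> 0"
  shows "isCont (signed_power r) y"
proof (cases "y = 0")
  case False
  have "isCont (\<lambda>y. y ^ (r - 1) * (sgn y) ^ r) y"
    using False by (intro continuous_intros) auto
  then show ?thesis by (simp add: signed_power_def[abs_def])
next
  case True
  have "((\<lambda>x::real. \<bar>x\<bar> ^ (r - 1)) \<longlongrightarrow> \<bar>0\<bar> ^ (r - 1)) (at 0)" by (intro tendsto_intros)
  then have "((\<lambda>x::real. \<bar>x\<bar> ^ (r - 1)) \<longlongrightarrow> 0) (at 0)" using assms True by (simp add: power_0_left)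
  then have "(signed_power r \<longlongrightarrow> 0) (at 0)"
    by (rule Lim_null_comparison[rotated]) (use abs_signed_power_le assms in auto)
  then show ?thesis using True assms by (simp add: isCont_def signed_power_eq)
qed

text \<open>For nonnegative numbers this is Bernoulli's inequality for (A / B)^r, multiplied by B^r.
  Signs are then absorbed by sgn b (a - b) \<le> |a| - |b|.\<close>

lemma abs_power_subgradient:
  assumes "r \<ge> 1"
  shows "\<bar>a\<bar> ^ r - \<bar>b\<bar> ^ r \<ge> real r * signed_power r b * (a - b)"
proof -
  obtain k where r: "r = Suc k" using assms by (cases r) auto
  have nonneg: "A ^ r - B ^ r \<ge> real r * B ^ k * (A - B)" if "A \<ge> 0" "B \<ge> 0" for A B :: real
  proof (cases "B = 0")
    case True
    then show ?thesis using that by (cases k) (auto simp: r)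
  next
    case False
    then have B: "B > 0" using that by simp
    have "-1 \<le> A / B - 1" using that by simp
    then have "1 + real r * (A / B - 1) \<le> (1 + (A / B - 1)) ^ r" by (rule Bernoulli_inequality)
    then have "B ^ r * (1 + real r * (A / B - 1)) \<le> B ^ r * (A / B) ^ r"
      using B by (intro mult_left_mono) auto
    also have "\<dots> = A ^ r" using B by (simp add: power_divide)
    also have "B ^ r * (1 + real r * (A / B - 1)) = B ^ r + real r * B ^ k * (A - B)"
      using B by (simp add: r field_simps)
    finally show ?thesis by simp
  qed
  have "signed_power r b * (a - b) \<le> \<bar>b\<bar> ^ k * (\<bar>a\<bar> - \<bar>b\<bar>)"
  proof -
    have "sgn b * (a - b) \<le> \<bar>a\<bar> - \<bar>b\<bar>" by (auto simp: sgn_if)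
    then have "\<bar>b\<bar> ^ k * (sgn b * (a - b)) \<le> \<bar>b\<bar> ^ k * (\<bar>a\<bar> - \<bar>b\<bar>)" by (intro mult_left_mono) auto
    then show ?thesis using signed_power_eq[OF assms, of b] by (simp add: r mult.assoc)
  qed
  then have "real r * (signed_power r b * (a - b)) \<le> real r * (\<bar>b\<bar> ^ k * (\<bar>a\<bar> - \<bar>b\<bar>))"
    by (intro mult_left_mono) auto
  also have "\<dots> \<le> \<bar>a\<bar> ^ r - \<bar>b\<bar> ^ r" using nonneg[of "\<bar>a\<bar>" "\<bar>b\<bar>"] by (simp add: mult.assoc)
  finally show ?thesis by (simp add: mult.assoc)
qed

text \<open>Convexity bounds the first-order Taylor remainder of \<open>|y - d|\<^sup>r\<close> at \<open>d = 0\<close> by the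
  increment of the subgradient, which is monotone; no second derivative is needed.\<close>

lemma abs_power_remainder:
  assumes r: "r \<ge> 1" and d: "\<bar>d\<bar> \<le> \<delta>"
  shows "\<bar>\<bar>y - d\<bar> ^ r - \<bar>y\<bar> ^ r + real r * d * signed_power r y\<bar> \<le>
    real r * \<bar>d\<bar> * (signed_power r (y + \<delta>) - signed_power r (y - \<delta>))"
proof -
  let ?\<rho> = "\<bar>y - d\<bar> ^ r - \<bar>y\<bar> ^ r + real r * d * signed_power r y"
  let ?s = "signed_power r"
  have lo: "?\<rho> \<ge> 0" using abs_power_subgradient[OF r, of y "y - d"] by (simp add: algebra_simps)
  \<comment> \<open>The subgradient at y has given nonnegativity; the one at the shifted point y - d
    gives the upper bound. Both values of the subgradient lie between those at y - \<delta> and y +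
    \<delta>.\<close>
  have "?\<rho> \<le> real r * (d * (?s y - ?s (y - d)))"
    using abs_power_subgradient[OF r, of "y - d" y] by (simp add: algebra_simps)
  also have "\<dots> \<le> real r * (\<bar>d\<bar> * (?s (y + \<delta>) - ?s (y - \<delta>)))"
  proof (intro mult_left_mono)
    have "d * (?s y - ?s (y - d)) \<le> \<bar>d\<bar> * \<bar>?s y - ?s (y - d)\<bar>"
      by (metis abs_ge_self abs_mult)
    also have "\<dots> \<le> \<bar>d\<bar> * (?s (y + \<delta>) - ?s (y - \<delta>))"
      using d mono_signed_power[OF r, of "y - \<delta>" "y - d"] mono_signed_power[OF r, of "y - d" "y + \<delta>"]
        mono_signed_power[OF r, of "y - \<delta>" y] mono_signed_power[OF r, of y "y + \<delta>"]
      by (intro mult_left_mono) (auto simp: abs_le_iff)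
    finally show "d * (?s y - ?s (y - d)) \<le> \<bar>d\<bar> * (?s (y + \<delta>) - ?s (y - \<delta>))" .
  qed simp
  finally show ?thesis using lo by (simp add: mult.assoc)
qed

lemma signed_power_measurable [measurable]: "signed_power r \<in> borel_measurable borel"
  unfolding signed_power_def by measurable

context iid_sample
begin

text \<open>The summand 1 makes the base at least 1, so every smaller power is dominated by the one
  of order 2 r. That one is controlled by |x - \<mu>| + 1 \<le> 2 max |x| (|\<mu>| + 1).\<close>

lemma integrable_abs_dev_power:
  fixes \<mu> :: real
  assumes "integrable M (\<lambda>\<omega>. X \<omega> ^ (2 * r))" and k: "k \<le> 2 * r"
  shows "integrable M (\<lambda>\<omega>. (\<bar>X \<omega> - \<mu>\<bar> + 1) ^ k)"
proof (rule Bochner_Integration.integrable_bound)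
  let ?A = "\<bar>\<mu>\<bar> + 1"
  show "integrable M (\<lambda>\<omega>. 2 ^ (2 * r) * (X \<omega> ^ (2 * r) + ?A ^ (2 * r)))"
    using assms by simp
  have "(\<bar>x - \<mu>\<bar> + 1) ^ k \<le> 2 ^ (2 * r) * (x ^ (2 * r) + ?A ^ (2 * r))" for x :: real
  proof -
    have "(\<bar>x - \<mu>\<bar> + 1) ^ k \<le> (\<bar>x - \<mu>\<bar> + 1) ^ (2 * r)" using k by (intro power_increasing) auto
    also have "\<dots> \<le> (2 * max \<bar>x\<bar> ?A) ^ (2 * r)"
      using abs_triangle_ineq4[of x \<mu>] by (intro power_mono) (auto simp: max_def)
    also have "\<dots> = 2 ^ (2 * r) * (max \<bar>x\<bar> ?A) ^ (2 * r)" by (rule power_mult_distrib)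
    also have "\<dots> \<le> 2 ^ (2 * r) * (\<bar>x\<bar> ^ (2 * r) + ?A ^ (2 * r))"
      by (intro mult_left_mono) (auto simp: max_def)
    finally show ?thesis by (simp add: power_even_abs)
  qed
  then show "AE \<omega> in M. norm ((\<bar>X \<omega> - \<mu>\<bar> + 1) ^ k) \<le> norm (2 ^ (2 * r) * (X \<omega> ^ (2 * r) + ?A ^ (2 * r)))"
    by (intro always_eventually allI) (smt (verit) abs_ge_self real_norm_def power_abs abs_add_one_gt_zero zero_le_power)
qed measurable

lemma sample_abs_central_moment_measurable [measurable]:
  "sample_abs_central_moment Xs n r \<in> borel_measurable M"
  unfolding sample_abs_central_moment_def sample_mean_def by measurable

text \<open>Dominated convergence along \<delta> = 1 / (k + 1): the increments are bounded by 2 (|X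
  - \<mu>| + 1)^(r - 1) and tend to 0 wherever \<open>signed_power r\<close> is continuous at X -
  \<mu>, hence almost surely.\<close>

lemma expectation_signed_power_increment:
  fixes \<mu> :: real
  assumes r: "r \<ge> 1" and mom: "integrable M (\<lambda>\<omega>. X \<omega> ^ (2 * r))"
    and ne: "r = 1 \<longrightarrow> (AE \<omega> in M. X \<omega> \<noteq> \<mu>)" and e: "e > 0"
  shows "\<exists>\<delta>>0. integrable M (\<lambda>\<omega>. signed_power r (X \<omega> - \<mu> + \<delta>) - signed_power r (X \<omega> - \<mu> - \<delta>)) \<and>
    expectation (\<lambda>\<omega>. signed_power r (X \<omega> - \<mu> + \<delta>) - signed_power r (X \<omega> - \<mu> - \<delta>)) < e"
proof -
  let ?s = "signed_power r"
  define \<delta> where "\<delta> k = inverse (real (Suc k))" for k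
  have \<delta>: "\<delta> k > 0" "\<delta> k \<le> 1" for k by (auto simp: \<delta>_def inverse_le_1_iff)
  define G where "G k \<omega> = ?s (X \<omega> - \<mu> + \<delta> k) - ?s (X \<omega> - \<mu> - \<delta> k)" for k \<omega>
  define B where "B \<omega> = 2 * (\<bar>X \<omega> - \<mu>\<bar> + 1) ^ (r - 1)" for \<omega>
  have B: "integrable M B" unfolding B_def using integrable_abs_dev_power[OF mom, of "r - 1"] by simp
  have [measurable]: "G k \<in> borel_measurable M" for k unfolding G_def by measurable
  have GB: "norm (G k \<omega>) \<le> B \<omega>" for k \<omega>
  proof -
    have "\<bar>?s z\<bar> \<le> (\<bar>X \<omega> - \<mu>\<bar> + 1) ^ (r - 1)" if "\<bar>z\<bar> \<le> \<bar>X \<omega> - \<mu>\<bar> + 1" for z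
      using abs_signed_power_le[OF r, of z] power_mono[OF that, of "r - 1"] by simp
    moreover have "\<bar>X \<omega> - \<mu> + \<delta> k\<bar> \<le> \<bar>X \<omega> - \<mu>\<bar> + 1" "\<bar>X \<omega> - \<mu> - \<delta> k\<bar> \<le> \<bar>X \<omega> - \<mu>\<bar> + 1"
      using \<delta>[of k] by linarith+
    ultimately have "\<bar>?s (X \<omega> - \<mu> + \<delta> k)\<bar> \<le> (\<bar>X \<omega> - \<mu>\<bar> + 1) ^ (r - 1)"
      "\<bar>?s (X \<omega> - \<mu> - \<delta> k)\<bar> \<le> (\<bar>X \<omega> - \<mu>\<bar> + 1) ^ (r - 1)" by blast+
    then show ?thesis unfolding G_def B_def real_norm_def by linarith
  qed
  have ae: "AE \<omega> in M. (\<lambda>k. G k \<omega>) \<longlonglongrightarrow> 0"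
  proof -
    have "(\<lambda>k. G k \<omega>) \<longlonglongrightarrow> 0" if "r \<ge> 2 \<or> X \<omega> - \<mu> \<noteq> 0" for \<omega>
    proof -
      have c: "isCont ?s (X \<omega> - \<mu>)" using isCont_signed_power[OF r that] .
      have \<delta>0: "\<delta> \<longlonglongrightarrow> 0" unfolding \<delta>_def by (rule LIMSEQ_inverse_real_of_nat)
      have "(\<lambda>k. G k \<omega>) \<longlonglongrightarrow> ?s (X \<omega> - \<mu>) - ?s (X \<omega> - \<mu>)"
        unfolding G_def
        using isCont_tendsto_compose[OF c, of "\<lambda>k. X \<omega> - \<mu> + \<delta> k" sequentially]
          isCont_tendsto_compose[OF c, of "\<lambda>k. X \<omega> - \<mu> - \<delta> k" sequentially]
          tendsto_add[OF tendsto_const \<delta>0, of "X \<omega> - \<mu>"] tendsto_diff[OF tendsto_const \<delta>0, of "X \<omega> - \<mu>"]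
        by (intro tendsto_diff) simp_all
      then show ?thesis by simp
    qed
    then show ?thesis using ne r by (cases "r = 1") (auto elim: AE_mp)
  qed
  have "(\<lambda>k. expectation (G k)) \<longlonglongrightarrow> expectation (\<lambda>_. 0)"
    by (rule integral_dominated_convergence[OF _ _ B]) (use ae GB in auto)
  then have "eventually (\<lambda>k. expectation (G k) < e) sequentially" using e by (intro order_tendstoD) auto
  then obtain k where "expectation (G k) < e" by (auto simp: eventually_sequentially)
  moreover have "norm (G k \<omega>) \<le> norm (B \<omega>)" for \<omega>
    by (metis GB abs_ge_self order_trans real_norm_def)
  then have "integrable M (G k)" by (intro Bochner_Integration.integrable_bound[OF B]) auto
  ultimately show ?thesis using \<delta>[of k] unfolding G_def by blast
qed

text \<open>The error of the representation is exactly R - r T L. T is the normed sum of the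
  deviations X - \<mu> and tight, L is the deviation of the mean subgradient from c and small by the
  law of large numbers, and R is the normed sum of the Taylor remainders.\<close>

lemma sample_abs_central_moment_representation:
  assumes r: "r \<ge> 1" and mom: "integrable M (\<lambda>\<omega>. X \<omega> ^ (2 * r))"
    and ne: "r = 1 \<longrightarrow> (AE \<omega> in M. X \<omega> \<noteq> expectation X)"
  defines "\<mu> \<equiv> expectation X" and "m \<equiv> abs_central_moment M X r"
  defines "c \<equiv> expectation (\<lambda>\<omega>. signed_power r (X \<omega> - \<mu>))"
  defines "g \<equiv> (\<lambda>x. \<bar>x - \<mu>\<bar> ^ r - m - real r * c * (x - \<mu>))"
  shows "integrable M (\<lambda>\<omega>. (g (X \<omega>))\<^sup>2)" and "expectation (\<lambda>\<omega>. g (X \<omega>)) = 0"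
    and "small_in_prob M (\<lambda>n \<omega>. sqrt (real n) * (sample_abs_central_moment Xs n r \<omega> - m) - normed_sum g n \<omega>)"
    and "tight_in_prob M (\<lambda>n \<omega>. sqrt (real n) * (sample_abs_central_moment Xs n r \<omega> - m))"
proof -
  let ?s = "signed_power r"
  have bound: "integrable M f" if f[measurable]: "f \<in> borel_measurable M"
    and le: "\<And>\<omega>. \<bar>f \<omega>\<bar> \<le> C * (\<bar>X \<omega> - \<mu>\<bar> + 1) ^ (2 * r)" for f :: "'a \<Rightarrow> real" and C
  proof (rule Bochner_Integration.integrable_bound)
    show "integrable M (\<lambda>\<omega>. C * (\<bar>X \<omega> - \<mu>\<bar> + 1) ^ (2 * r))"
      using integrable_abs_dev_power[OF mom order_refl] by simp
    show "AE \<omega> in M. norm (f \<omega>) \<le> norm (C * (\<bar>X \<omega> - \<mu>\<bar> + 1) ^ (2 * r))"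
      by (intro always_eventually allI) (metis le abs_ge_self order_trans real_norm_def)
  qed simp
  have pw: "\<bar>y\<bar> ^ k \<le> (\<bar>y\<bar> + 1) ^ (2 * r)" if "k \<le> 2 * r" for k and y :: real
  proof -
    have "\<bar>y\<bar> ^ k \<le> (\<bar>y\<bar> + 1) ^ k" by (intro power_mono) auto
    also have "\<dots> \<le> (\<bar>y\<bar> + 1) ^ (2 * r)" using that by (intro power_increasing) auto
    finally show ?thesis .
  qed
  have pwint: "integrable M (\<lambda>\<omega>. \<bar>X \<omega> - \<mu>\<bar> ^ k)" if "k \<le> 2 * r" for k
    using pw[OF that] by (intro bound[of _ 1]) auto
  have X_int: "integrable M X"
  proof -
    have "integrable M (\<lambda>\<omega>. X \<omega> - \<mu>)" using pw[of 1] r by (intro bound[of _ 1]) auto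
    then have "integrable M (\<lambda>\<omega>. X \<omega> - \<mu> + \<mu>)" by (rule Bochner_Integration.integrable_add) simp
    then show ?thesis by simp
  qed
  have X2_int: "integrable M (\<lambda>\<omega>. (X \<omega> - \<mu>)\<^sup>2)" using pwint[of 2] r by simp
  have Xm: "expectation (\<lambda>\<omega>. X \<omega> - \<mu>) = 0" using X_int by (simp add: \<mu>_def prob_space)
  have s2: "(?s y)\<^sup>2 \<le> (\<bar>y\<bar> + 1) ^ (2 * r)" for y
  proof -
    have "(?s y)\<^sup>2 = \<bar>?s y\<bar>\<^sup>2" by simp
    also have "\<dots> \<le> (\<bar>y\<bar> ^ (r - 1))\<^sup>2" using abs_signed_power_le[OF r] by (intro power_mono) auto
    also have "\<dots> = \<bar>y\<bar> ^ (2 * (r - 1))" by (metis mult.commute power_mult)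
    also have "\<dots> \<le> (\<bar>y\<bar> + 1) ^ (2 * r)" by (rule pw) auto
    finally show ?thesis .
  qed
  have s2_int: "integrable M (\<lambda>\<omega>. (?s (X \<omega> - \<mu>))\<^sup>2)"
    using s2 by (intro bound[of _ 1]) auto
  have s_int: "integrable M (\<lambda>\<omega>. ?s (X \<omega> - \<mu>))"
    by (rule square_integrable_imp_integrable[OF _ s2_int]) measurable
  have g_m[measurable]: "g \<in> borel_measurable borel" unfolding g_def by measurable
  have sq_add: "integrable M (\<lambda>\<omega>. (f \<omega> + h \<omega>)\<^sup>2)"
    if [measurable]: "f \<in> borel_measurable M" "h \<in> borel_measurable M"
      and i: "integrable M (\<lambda>\<omega>. (f \<omega>)\<^sup>2)" "integrable M (\<lambda>\<omega>. (h \<omega>)\<^sup>2)" for f h :: "'a \<Rightarrow> real"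
  proof (rule Bochner_Integration.integrable_bound)
    show "integrable M (\<lambda>\<omega>. 2 * (f \<omega>)\<^sup>2 + 2 * (h \<omega>)\<^sup>2)" using i by simp
    have "(a + b)\<^sup>2 \<le> 2 * a\<^sup>2 + 2 * b\<^sup>2" for a b :: real
      using zero_le_power2[of "a - b"] by (simp add: power2_eq_square algebra_simps)
    then show "AE \<omega> in M. norm ((f \<omega> + h \<omega>)\<^sup>2) \<le> norm (2 * (f \<omega>)\<^sup>2 + 2 * (h \<omega>)\<^sup>2)" by simp
  qed measurable
  show g_sq: "integrable M (\<lambda>\<omega>. (g (X \<omega>))\<^sup>2)"
  proof -
    have 1: "integrable M (\<lambda>\<omega>. (\<bar>X \<omega> - \<mu>\<bar> ^ r)\<^sup>2)"
      using pwint[of "2 * r"] by (simp add: power_mult[symmetric] mult.commute)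
    have 2: "integrable M (\<lambda>\<omega>. (- (real r * c) * (X \<omega> - \<mu>))\<^sup>2)"
      using X2_int by (simp add: power_mult_distrib)
    have 3: "integrable M (\<lambda>\<omega>. (\<bar>X \<omega> - \<mu>\<bar> ^ r + (- (real r * c) * (X \<omega> - \<mu>)))\<^sup>2)"
      by (rule sq_add[OF _ _ 1 2]; measurable)
    have "integrable M (\<lambda>\<omega>. (\<bar>X \<omega> - \<mu>\<bar> ^ r + (- (real r * c) * (X \<omega> - \<mu>)) + (- m))\<^sup>2)"
      by (rule sq_add[OF _ _ 3]) simp_all
    then show ?thesis by (simp add: g_def algebra_simps)
  qed
  show g_mean: "expectation (\<lambda>\<omega>. g (X \<omega>)) = 0"
  proof -
    have "expectation (\<lambda>\<omega>. g (X \<omega>)) =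
      expectation (\<lambda>\<omega>. \<bar>X \<omega> - \<mu>\<bar> ^ r) - m - real r * c * expectation (\<lambda>\<omega>. X \<omega> - \<mu>)"
      unfolding g_def using pwint[of r] X_int by (simp add: prob_space)
    then show ?thesis unfolding Xm by (simp add: m_def abs_central_moment_def \<mu>_def)
  qed
  define T where "T = normed_sum (\<lambda>x. x - \<mu>)"
  have tT: "tight_in_prob M T" unfolding T_def by (rule tight_normed_sum[OF _ X2_int Xm]) measurable
  note [measurable] = tight_in_prob_measurable[OF tT]
  define L where "L n \<omega> = (\<Sum>i<n. ?s (Xs i \<omega> - \<mu>) - c) / real n" for n \<omega>
  have sL: "small_in_prob M L"
    unfolding L_def
  proof (rule weak_law[of "\<lambda>x. ?s (x - \<mu>) - c"])
    show "integrable M (\<lambda>\<omega>. (?s (X \<omega> - \<mu>) - c)\<^sup>2)"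
      using sq_add[of "\<lambda>\<omega>. ?s (X \<omega> - \<mu>)" "\<lambda>_. - c"] s2_int by simp
    show "expectation (\<lambda>\<omega>. ?s (X \<omega> - \<mu>) - c) = 0" using s_int by (simp add: c_def prob_space)
  qed measurable
  define D where "D n \<omega> = sample_mean Xs n \<omega> - \<mu>" for n \<omega>
  have DT: "sqrt (real n) * D n \<omega> = T n \<omega>" if "n > 0" for n \<omega>
  proof -
    have "D n \<omega> = (\<Sum>i<n. Xs i \<omega> - \<mu>) / real n"
      using that by (simp add: D_def sample_mean_def sum_subtractf field_simps)
    then show ?thesis using that by (simp add: T_def normed_sum_def field_simps)
  qed
  \<comment> \<open>The first-order Taylor remainder in d, with the derivative of |y|^r replaced by
    its subgradient so that the formula also makes sense at y = 0 for r = 1.\<close>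
  define \<rho> where "\<rho> y d = \<bar>y - d\<bar> ^ r - \<bar>y\<bar> ^ r + real r * d * ?s y" for y d
  define R where "R n \<omega> = (\<Sum>i<n. \<rho> (Xs i \<omega> - \<mu>) (D n \<omega>)) / sqrt (real n)" for n \<omega>
  have [measurable]: "D n \<in> borel_measurable M" for n unfolding D_def sample_mean_def by measurable
  have [measurable]: "R n \<in> borel_measurable M" for n unfolding R_def \<rho>_def by measurable
  have decomp: "sqrt (real n) * (sample_abs_central_moment Xs n r \<omega> - m) - normed_sum g n \<omega> =
     R n \<omega> + (- real r) * (T n \<omega> * L n \<omega>)" for n \<omega>
  proof (cases "n = 0")
    case True
    then show ?thesis by (simp add: R_def L_def normed_sum_def)
  next
    case False
    then have n: "n > 0" by simp
    let ?Y = "\<lambda>i. Xs i \<omega> - \<mu>" and ?n = "sqrt (real n)"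
    have "sqrt (real n) * (sample_abs_central_moment Xs n r \<omega> - m) = (\<Sum>i<n. \<bar>?Y i - D n \<omega>\<bar> ^ r - m) / ?n"
    proof -
      have "(\<Sum>i<n. \<bar>?Y i - D n \<omega>\<bar> ^ r - m) = real n * (sample_abs_central_moment Xs n r \<omega> - m)"
        using n by (simp add: sample_abs_central_moment_def D_def sum_subtractf field_simps)
      then show ?thesis using n by (simp add: field_simps)
    qed
    then have "(sqrt (real n) * (sample_abs_central_moment Xs n r \<omega> - m) - normed_sum g n \<omega>) =
      (\<Sum>i<n. (\<bar>?Y i - D n \<omega>\<bar> ^ r - m) - g (Xs i \<omega>)) / ?n"
      by (simp add: normed_sum_def sum_subtractf diff_divide_distrib)
    also have "(\<Sum>i<n. (\<bar>?Y i - D n \<omega>\<bar> ^ r - m) - g (Xs i \<omega>)) =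
      (\<Sum>i<n. \<rho> (?Y i) (D n \<omega>) - real r * D n \<omega> * (?s (?Y i) - c) + real r * c * (?Y i - D n \<omega>))"
      by (rule sum.cong) (auto simp: \<rho>_def g_def algebra_simps)
    also have "\<dots> = (\<Sum>i<n. \<rho> (?Y i) (D n \<omega>)) - real r * D n \<omega> * (\<Sum>i<n. ?s (?Y i) - c)
        + real r * c * (\<Sum>i<n. ?Y i - D n \<omega>)"
      by (subst sum.distrib, subst sum_subtractf, simp only: sum_distrib_left)
    \<comment> \<open>Residuals from the sample mean sum to 0. This is what lets the linear term of
      \<open>g\<close> absorb r c times the shift of the centre.\<close>
    also have "(\<Sum>i<n. ?Y i - D n \<omega>) = 0"
      using n by (simp add: D_def sample_mean_def sum_subtractf)
    also have "((\<Sum>i<n. \<rho> (?Y i) (D n \<omega>)) - real r * D n \<omega> * (\<Sum>i<n. ?s (?Y i) - c) + real r * c * 0) / ?n =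
       R n \<omega> - real r * (?n * D n \<omega>) * L n \<omega>"
      using n unfolding R_def L_def by (simp add: diff_divide_distrib) (simp add: field_simps)
    finally show ?thesis unfolding DT[OF n] by simp
  qed
  have sR: "small_in_prob M R"
  proof (rule small_in_probI)
    fix e d :: real assume ed: "e > 0" "d > 0"
    obtain K where K: "K > 0" "eventually (\<lambda>n. prob {\<omega> \<in> space M. K < \<bar>T n \<omega>\<bar>} < d/2) sequentially"
      using tight_in_probE[OF tT, of "d/2"] ed by auto
    \<comment> \<open>Since |T| \<le> K bounds sqrt n |D|, the remainder R is at most r K times the
      mean A of the increments, and r K \<epsilon> = e. The increments have mean below \<epsilon>
      d/2, so by Markov A reaches \<epsilon> with probability below d/2.\<close>
    define \<epsilon> where "\<epsilon> = e / (real r * K)"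
    have \<epsilon>: "\<epsilon> > 0" using ed K r by (simp add: \<epsilon>_def)
    obtain \<delta> where \<delta>: "\<delta> > 0"
      "integrable M (\<lambda>\<omega>. ?s (X \<omega> - \<mu> + \<delta>) - ?s (X \<omega> - \<mu> - \<delta>))"
      "expectation (\<lambda>\<omega>. ?s (X \<omega> - \<mu> + \<delta>) - ?s (X \<omega> - \<mu> - \<delta>)) < \<epsilon> * (d/2)"
      using expectation_signed_power_increment[OF r mom ne[folded \<mu>_def], of "\<epsilon> * (d/2)"] \<epsilon> ed by auto
    define G where "G x = ?s (x - \<mu> + \<delta>) - ?s (x - \<mu> - \<delta>)" for x
    have G_m[measurable]: "G \<in> borel_measurable borel" unfolding G_def by measurable
    have G0: "G x \<ge> 0" for x unfolding G_def using mono_signed_power[OF r, of "x - \<mu> - \<delta>" "x - \<mu> + \<delta>"] \<delta>(1) by simp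
    have Gi: "integrable M (\<lambda>\<omega>. G (Xs i \<omega>))" "expectation (\<lambda>\<omega>. G (Xs i \<omega>)) < \<epsilon> * (d/2)" for i
      using \<delta>(2,3) integrable_Xs_iff[OF G_m, of i] expectation_Xs[OF G_m, of i] by (simp_all add: G_def)
    define A where "A n \<omega> = (\<Sum>i<n. G (Xs i \<omega>)) / real n" for n \<omega>
    have A_m[measurable]: "A n \<in> borel_measurable M" for n unfolding A_def by measurable
    have A0: "A n \<omega> \<ge> 0" for n \<omega> unfolding A_def using G0 by (simp add: sum_nonneg)
    have PA: "prob {\<omega> \<in> space M. A n \<omega> \<ge> \<epsilon>} < d/2" if n: "n > 0" for n
    proof -
      have "prob {\<omega> \<in> space M. A n \<omega> \<ge> \<epsilon>} \<le> expectation (A n) / \<epsilon>"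
        using A0 Gi(1) \<epsilon> by (intro integral_Markov_inequality_measure[of _ _ "{}"]) (auto simp: A_def[abs_def])
      also have "expectation (A n) = (\<Sum>i<n. expectation (\<lambda>\<omega>. G (Xs i \<omega>))) / real n"
        unfolding A_def using Gi(1) by simp
      also have "(\<Sum>i<n. expectation (\<lambda>\<omega>. G (Xs i \<omega>))) < (\<Sum>i<n. \<epsilon> * (d/2))"
        using Gi(2) n by (intro sum_strict_mono) auto
      finally show ?thesis using n \<epsilon> by (simp add: field_simps)
    qed
    have "eventually (\<lambda>n. sqrt (real n) > K/\<delta>) sequentially"
      using filterlim_compose[OF sqrt_at_top filterlim_real_sequentially] by (auto simp: filterlim_at_top_dense)
    with K(2) eventually_gt_at_top[of 0]
    show "eventually (\<lambda>n. prob {\<omega> \<in> space M. e < \<bar>R n \<omega>\<bar>} < d) sequentially"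
    proof eventually_elim
      case (elim n)
      have n: "n > 0" by (fact elim(2))
      have bd: "\<not> e < \<bar>R n \<omega>\<bar>" if TK: "\<not> K < \<bar>T n \<omega>\<bar>" and A\<epsilon>: "\<not> A n \<omega> \<ge> \<epsilon>" for \<omega>
      proof -
        let ?n = "sqrt (real n)"
        have n0: "?n > 0" using n by simp
        have "?n * \<bar>D n \<omega>\<bar> = \<bar>T n \<omega>\<bar>" using DT[OF n, of \<omega>] n0 by (metis abs_mult abs_of_pos)
        then have "?n * \<bar>D n \<omega>\<bar> \<le> K" using TK by simp
        also have "K < ?n * \<delta>" using elim(3) \<delta>(1) by (simp add: field_simps)
        \<comment> \<open>The shift of the centre is now small enough for the remainder bound with
          the fixed \<delta>, uniformly over the summands.\<close>
        finally have D\<delta>: "\<bar>D n \<omega>\<bar> \<le> \<delta>" using n0 by simp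
        have "\<bar>R n \<omega>\<bar> \<le> (\<Sum>i<n. \<bar>\<rho> (Xs i \<omega> - \<mu>) (D n \<omega>)\<bar>) / ?n"
          unfolding R_def by (simp add: divide_right_mono)
        also have "\<dots> \<le> (\<Sum>i<n. real r * \<bar>D n \<omega>\<bar> * G (Xs i \<omega>)) / ?n"
          unfolding \<rho>_def G_def using abs_power_remainder[OF r D\<delta>] by (intro divide_right_mono sum_mono) auto
        also have "\<dots> = real r * (?n * \<bar>D n \<omega>\<bar>) * A n \<omega>"
          unfolding sum_distrib_left[symmetric] A_def using n by (simp add: field_simps)
        also have "\<dots> \<le> real r * K * \<epsilon>"
          using \<open>?n * \<bar>D n \<omega>\<bar> \<le> K\<close> A\<epsilon> A0 K by (intro mult_mono mult_left_mono) auto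
        also have "\<dots> = e" using r K by (simp add: \<epsilon>_def)
        finally show ?thesis by simp
      qed
      then have "{\<omega> \<in> space M. e < \<bar>R n \<omega>\<bar>} \<subseteq> {\<omega> \<in> space M. K < \<bar>T n \<omega>\<bar>} \<union> {\<omega> \<in> space M. A n \<omega> \<ge> \<epsilon>}"
        by blast
      then show ?case by (rule prob_less_if_subset_Un[OF _ _ _ elim(1) PA[OF n]]) measurable
    qed
  qed measurable
  show small: "small_in_prob M (\<lambda>n \<omega>. sqrt (real n) * (sample_abs_central_moment Xs n r \<omega> - m) - normed_sum g n \<omega>)"
    unfolding decomp
    by (rule small_in_prob_add[OF sR small_in_prob_cmult[OF small_in_prob_tight_mult[OF tT sL]]])
  show "tight_in_prob M (\<lambda>n \<omega>. sqrt (real n) * (sample_abs_central_moment Xs n r \<omega> - m))"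
    using tight_in_prob_add_small[OF tight_normed_sum[OF g_m g_sq g_mean] small] by simp
qed

end

section \<open>Joint asymptotics\<close>

text \<open>At (- s12, s11) the form equals s11 times the determinant. If s11 = 0 and s12 were
  nonzero, the point used in that case would give the value -1.\<close>

lemma quadratic_form_nonneg_imp_det:
  fixes s11 s12 s22 :: real
  assumes q: "\<And>a b. 0 \<le> a\<^sup>2 * s11 + 2 * a * b * s12 + b\<^sup>2 * s22"
  shows "s12\<^sup>2 \<le> s11 * s22"
proof (cases "s11 = 0")
  case True
  have "s12 = 0"
  proof (rule ccontr)
    assume "s12 \<noteq> 0"
    then show False using q[of "- (s22 + 1) / (2 * s12)" 1] True by (simp add: field_simps)
  qed
  then show ?thesis using True by simp
next
  case False
  then have "s11 > 0" using q[of 1 0] by simp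
  have "s11 * s12\<^sup>2 \<le> s11 * (s11 * s22)"
    using q[of "- s12" s11] by (simp add: power2_eq_square algebra_simps)
  then show ?thesis using \<open>s11 > 0\<close> by simp
qed

lemma (in prob_space) distributed_lborel_AE_neq:
  assumes "distributed M lborel X f"
  shows "AE \<omega> in M. X \<omega> \<noteq> (c::real)"
proof -
  have X: "X \<in> measurable M lborel" and D: "distr M lborel X = density lborel f"
    and f[measurable]: "f \<in> borel_measurable lborel"
    using assms by (auto simp: distributed_def)
  have "AE x in density lborel f. x \<noteq> c"
    using AE_lborel_singleton[of c] by (subst AE_density) auto
  then have "AE x in distr M lborel X. x \<noteq> c" by (simp only: D)
  then show ?thesis by (subst (asm) AE_distr_iff[OF X]) auto
qed

theorem theorem4:
  fixes M :: "'a measure" and X :: "'a \<Rightarrow> real" and Xs :: "nat \<Rightarrow> 'a \<Rightarrow> real"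
    and p :: real and r :: nat and h1 h2 :: "real \<Rightarrow> real" and fq d1 d2 :: real
  assumes "prob_space M"
    and "X \<in> borel_measurable M"
    and "prob_space.indep_vars M (\<lambda>_. borel) Xs UNIV"
    and "\<And>i. distr M borel (Xs i) = distr M borel X"
    and "integrable M X" and "integrable M (\<lambda>\<omega>. (X \<omega>)\<^sup>2)"
    and "0 < p" and "p < 1" and "r \<ge> 1"
    and "(cdf_rv M X has_real_derivative fq) (at (quantile_rv M X p))" and "fq > 0"
    and "integrable M (\<lambda>\<omega>. X \<omega> ^ (2 * r))"
    and "r = 1 \<Longrightarrow> \<exists>f. distributed M lborel X f \<and> f (\<integral>\<omega>. X \<omega> \<partial>M) > 0"
    and "continuous_on UNIV h1" and "continuous_on UNIV h2"
    and "(h1 has_real_derivative d1) (at (quantile_rv M X p))"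
    and "(h2 has_real_derivative d2) (at (abs_central_moment M X r))"
  shows
    "let \<mu> = (\<integral>\<omega>. X \<omega> \<partial>M);
         q = quantile_rv M X p;
         m = abs_central_moment M X r;
         c = (\<integral>\<omega>. (X \<omega> - \<mu>) ^ (r - 1) * (sgn (X \<omega> - \<mu>)) ^ r \<partial>M);
         V = prob_space.variance M (\<lambda>\<omega>. \<bar>X \<omega> - \<mu>\<bar> ^ r - real r * c * (X \<omega> - \<mu>));
         T = tau M X (\<lambda>x. \<bar>x - \<mu>\<bar>) r p - real r * c * tau M X (\<lambda>x. x) 1 p;
         s11 = p * (1 - p) / fq\<^sup>2 * d1\<^sup>2;
         s22 = d2\<^sup>2 * V;
         s12 = d1 * d2 * T / fq
     in \<exists>N. bivariate_normal N s11 s12 s22 \<and>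
            conv_distr2 M (\<lambda>n \<omega>. (sqrt (real n) * (h1 (sample_quantile Xs n p \<omega>) - h1 q),
                                  sqrt (real n) * (h2 (sample_abs_central_moment Xs n r \<omega>) - h2 m))) N \<and>
            (d1 * d2 \<noteq> 0 \<and> V > 0 \<longrightarrow>
               correlation2 N = sgn (d1 * d2) * T / sqrt (p * (1 - p) * V))"
proof -
  interpret prob_space M by fact
  interpret iid_sample M X Xs
    using assms(2-4) by unfold_locales auto
  note p = \<open>0 < p\<close> \<open>p < 1\<close> and r = \<open>r \<ge> 1\<close> and fq = \<open>fq > 0\<close>
  define \<mu> where "\<mu> = expectation X"
  define q where "q = quantile_rv M X p"
  define m where "m = abs_central_moment M X r"
  define c where "c = expectation (\<lambda>\<omega>. signed_power r (X \<omega> - \<mu>))"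
  define Z where "Z \<omega> = \<bar>X \<omega> - \<mu>\<bar> ^ r - real r * c * (X \<omega> - \<mu>)" for \<omega>
  define V where "V = variance Z"
  define T where "T = tau M X (\<lambda>x. \<bar>x - \<mu>\<bar>) r p - real r * c * tau M X (\<lambda>x. x) 1 p"
  define s11 where "s11 = p * (1 - p) / fq\<^sup>2 * d1\<^sup>2"
  define s22 where "s22 = d2\<^sup>2 * V"
  define s12 where "s12 = d1 * d2 * T / fq"
  define w where "w x = (p - indicator {..q} x) / fq" for x :: real
  define g where "g = (\<lambda>x. \<bar>x - \<mu>\<bar> ^ r - m - real r * c * (x - \<mu>))"

  \<comment> \<open>A law with a density charges no point, in particular not the mean, where sgn
    would be discontinuous.\<close>
  have ne: "r = 1 \<longrightarrow> (AE \<omega> in M. X \<omega> \<noteq> expectation X)"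
    using assms(13) distributed_lborel_AE_neq by blast
  note rep_q = sample_quantile_representation[OF p assms(10) fq, folded q_def, folded w_def]
  note rep_m = sample_abs_central_moment_representation[OF r assms(12) ne, folded \<mu>_def, folded c_def m_def, folded g_def]
  have w_m[measurable]: "w \<in> borel_measurable borel" unfolding w_def by measurable
  have g_m[measurable]: "g \<in> borel_measurable borel" unfolding g_def by measurable
  have g_sq: "integrable M (\<lambda>\<omega>. (g (X \<omega>))\<^sup>2)" using rep_m(1) by (simp add: g_def)
  have g_mean: "expectation (\<lambda>\<omega>. g (X \<omega>)) = 0" using rep_m(2) by (simp add: g_def)
  have h_m[measurable]: "h1 \<in> borel_measurable borel" "h2 \<in> borel_measurable borel"
    using assms(14,15) by (auto intro: borel_measurable_continuous_onI)
  note sq_m[measurable] = sample_quantile_measurable[OF p]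

  \<comment> \<open>Second moments of the two influence functions\<close>
  have Fq: "cdf_rv M X q = p"
    unfolding q_def using assms(10) by (intro cdf_rv_quantile_rv[OF X_measurable p] DERIV_isCont)
  define A where "A = {\<omega> \<in> space M. X \<omega> > q}"
  have [measurable]: "A \<in> events" unfolding A_def by measurable
  have PA: "prob A = 1 - p"
    using Fq prob_neg[of "\<lambda>\<omega>. X \<omega> \<le> q"] by (simp add: A_def cdf_rv_def not_le)
  \<comment> \<open>Passing to the complement of {X \<le> q} brings in the upper tail event on which
    \<open>tau\<close> conditions.\<close>
  have w_A: "w (X \<omega>) = (indicator A \<omega> - (1 - p)) / fq" if "\<omega> \<in> space M" for \<omega>
    using that by (auto simp: w_def A_def indicator_def)
  have intA: "integrable M (indicator A :: 'a \<Rightarrow> real)" by (simp add: less_top[symmetric])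
  have intAf: "integrable M (\<lambda>\<omega>. indicator A \<omega> * f \<omega>)" if "integrable M f" for f :: "'a \<Rightarrow> real"
    using integrable_mult_indicator[OF \<open>A \<in> events\<close> that] by simp
  have w_mean: "expectation (\<lambda>\<omega>. w (X \<omega>)) = 0"
  proof -
    have "expectation (\<lambda>\<omega>. w (X \<omega>)) = expectation (\<lambda>\<omega>. (indicator A \<omega> - (1 - p)) / fq)"
      by (rule Bochner_Integration.integral_cong) (auto simp: w_A)
    also have "\<dots> = 0" using intA by (simp add: PA prob_space)
    finally show ?thesis .
  qed
  \<comment> \<open>An indicator is its own square, so the square is affine in it, with slope 1 - 2
    (1 - p) = 2 p - 1.\<close>
  have w2_eq: "(w (X \<omega>))\<^sup>2 = ((2 * p - 1) * indicator A \<omega> + (1 - p)\<^sup>2) / fq\<^sup>2" if "\<omega> \<in> space M" for \<omega>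
    unfolding w_A[OF that] by (auto simp: indicator_def power_divide power2_eq_square algebra_simps)
  have w_var: "integrable M (\<lambda>\<omega>. (w (X \<omega>))\<^sup>2)" "expectation (\<lambda>\<omega>. (w (X \<omega>))\<^sup>2) = p * (1 - p) / fq\<^sup>2"
  proof -
    have "integrable M (\<lambda>\<omega>. ((2 * p - 1) * indicator A \<omega> + (1 - p)\<^sup>2) / fq\<^sup>2)" using intA by simp
    then show "integrable M (\<lambda>\<omega>. (w (X \<omega>))\<^sup>2)"
      by (rule Bochner_Integration.integrable_cong[THEN iffD1, rotated -1]) (auto simp: w2_eq)
    have "expectation (\<lambda>\<omega>. (w (X \<omega>))\<^sup>2) = expectation (\<lambda>\<omega>. ((2 * p - 1) * indicator A \<omega> + (1 - p)\<^sup>2) / fq\<^sup>2)"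
      by (rule Bochner_Integration.integral_cong) (auto simp: w2_eq)
    also have "\<dots> = ((2 * p - 1) * (1 - p) + (1 - p)\<^sup>2) / fq\<^sup>2" using intA by (simp add: PA prob_space)
    also have "(2 * p - 1) * (1 - p) + (1 - p)\<^sup>2 = p * (1 - p)" by (simp add: power2_eq_square algebra_simps)
    finally show "expectation (\<lambda>\<omega>. (w (X \<omega>))\<^sup>2) = p * (1 - p) / fq\<^sup>2" .
  qed
  have absr_int: "integrable M (\<lambda>\<omega>. \<bar>X \<omega> - \<mu>\<bar> ^ r)"
  proof (rule Bochner_Integration.integrable_bound)
    show "integrable M (\<lambda>\<omega>. (\<bar>X \<omega> - \<mu>\<bar> + 1) ^ r)" by (rule integrable_abs_dev_power[OF assms(12)]) simp
    show "AE \<omega> in M. norm (\<bar>X \<omega> - \<mu>\<bar> ^ r) \<le> norm ((\<bar>X \<omega> - \<mu>\<bar> + 1) ^ r)"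
      by (auto simp: power_abs intro!: power_mono)
  qed measurable
  have m_eq: "expectation (\<lambda>\<omega>. \<bar>X \<omega> - \<mu>\<bar> ^ r) = m" by (simp add: m_def abs_central_moment_def \<mu>_def)
  have Z_int: "integrable M Z" unfolding Z_def using absr_int assms(5) by simp
  have Z_mean: "expectation Z = m"
    unfolding Z_def using absr_int assms(5) by (simp add: m_eq prob_space \<mu>_def[symmetric])
  have gZ: "g (X \<omega>) = Z \<omega> - m" for \<omega> by (simp add: g_def Z_def)
  have g_var: "expectation (\<lambda>\<omega>. (g (X \<omega>))\<^sup>2) = V" unfolding V_def Z_mean gZ ..
  \<comment> \<open>The factor 1 - p in \<open>tau\<close> cancels the probability of
    \<open>A\<close> in the conditional expectation, so each \<open>tau\<close> is a mean over
    \<open>A\<close> minus 1 - p times the full mean. The subtracted terms are just what centring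
    \<open>g\<close> contributes on \<open>A\<close>.\<close>
  have T_eq: "T = expectation (\<lambda>\<omega>. indicator A \<omega> * g (X \<omega>))"
  proof -
    have t1: "tau M X (\<lambda>x. \<bar>x - \<mu>\<bar>) r p = expectation (\<lambda>\<omega>. indicator A \<omega> * \<bar>X \<omega> - \<mu>\<bar> ^ r) - (1 - p) * m"
      using p by (simp add: tau_def cond_exp_event_def q_def[symmetric] A_def[symmetric] PA m_eq field_simps)
    have t2: "tau M X (\<lambda>x. x) 1 p = expectation (\<lambda>\<omega>. indicator A \<omega> * X \<omega>) - (1 - p) * \<mu>"
      using p by (simp add: tau_def cond_exp_event_def q_def[symmetric] A_def[symmetric] PA \<mu>_def field_simps)
    have "expectation (\<lambda>\<omega>. indicator A \<omega> * g (X \<omega>)) =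
      expectation (\<lambda>\<omega>. indicator A \<omega> * \<bar>X \<omega> - \<mu>\<bar> ^ r - real r * c * (indicator A \<omega> * X \<omega>)
         + (real r * c * \<mu> - m) * indicator A \<omega>)"
      by (rule Bochner_Integration.integral_cong) (auto simp: g_def algebra_simps)
    also have "\<dots> = expectation (\<lambda>\<omega>. indicator A \<omega> * \<bar>X \<omega> - \<mu>\<bar> ^ r)
       - real r * c * expectation (\<lambda>\<omega>. indicator A \<omega> * X \<omega>) + (real r * c * \<mu> - m) * (1 - p)"
    proof -
      have lin: "expectation (\<lambda>\<omega>. f1 \<omega> - k1 * f2 \<omega> + k2 * f3 \<omega>) = expectation f1 - k1 * expectation f2 + k2 * expectation f3"
        if "integrable M f1" "integrable M f2" "integrable M f3" for f1 f2 f3 and k1 k2 :: real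
        using that by simp
      show ?thesis
        unfolding lin[OF intAf[OF absr_int] intAf[OF assms(5)] intA] by (simp add: PA)
    qed
    finally have t3: "expectation (\<lambda>\<omega>. indicator A \<omega> * g (X \<omega>)) = expectation (\<lambda>\<omega>. indicator A \<omega> * \<bar>X \<omega> - \<mu>\<bar> ^ r)
       - real r * c * expectation (\<lambda>\<omega>. indicator A \<omega> * X \<omega>) + (real r * c * \<mu> - m) * (1 - p)" .
    show ?thesis unfolding T_def t1 t2 t3 by (simp add: algebra_simps)
  qed
  have g_int: "integrable M (\<lambda>\<omega>. g (X \<omega>))" unfolding gZ using Z_int by simp
  \<comment> \<open>The term with the factor 1 - p has mean 0 because \<open>g\<close> is centred,
    which leaves the mean of \<open>g\<close> over the tail event.\<close>
  have wg_eq: "w (X \<omega>) * g (X \<omega>) = (indicator A \<omega> * g (X \<omega>) - (1 - p) * g (X \<omega>)) / fq" if "\<omega> \<in> space M" for \<omega>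
    by (simp add: w_A[OF that] algebra_simps)
  have wg: "integrable M (\<lambda>\<omega>. w (X \<omega>) * g (X \<omega>))" "expectation (\<lambda>\<omega>. w (X \<omega>) * g (X \<omega>)) = T / fq"
  proof -
    have "integrable M (\<lambda>\<omega>. (indicator A \<omega> * g (X \<omega>) - (1 - p) * g (X \<omega>)) / fq)"
      using intAf[OF g_int] g_int by simp
    then show "integrable M (\<lambda>\<omega>. w (X \<omega>) * g (X \<omega>))"
      by (rule Bochner_Integration.integrable_cong[THEN iffD1, rotated -1]) (auto simp: wg_eq)
    have "expectation (\<lambda>\<omega>. w (X \<omega>) * g (X \<omega>)) = expectation (\<lambda>\<omega>. (indicator A \<omega> * g (X \<omega>) - (1 - p) * g (X \<omega>)) / fq)"
      by (rule Bochner_Integration.integral_cong) (auto simp: wg_eq)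
    also have "\<dots> = T / fq"
      using intAf[OF g_int] g_int g_mean by (simp add: T_eq)
    finally show "expectation (\<lambda>\<omega>. w (X \<omega>) * g (X \<omega>)) = T / fq" .
  qed

  \<comment> \<open>Linear combinations and existence of the limit law\<close>
  define k where "k a b x = a * d1 * w x + b * d2 * g x" for a b x
  have k_m[measurable]: "k a b \<in> borel_measurable borel" for a b unfolding k_def by measurable
  have w_int: "integrable M (\<lambda>\<omega>. w (X \<omega>))"
    by (rule square_integrable_imp_integrable[OF _ w_var(1)]) measurable
  have k_mean: "expectation (\<lambda>\<omega>. k a b (X \<omega>)) = 0" for a b
    unfolding k_def using w_int g_int w_mean g_mean by simp
  have k_var: "integrable M (\<lambda>\<omega>. (k a b (X \<omega>))\<^sup>2)"
    "expectation (\<lambda>\<omega>. (k a b (X \<omega>))\<^sup>2) = a\<^sup>2 * s11 + 2 * a * b * s12 + b\<^sup>2 * s22" for a b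
  proof -
    have eq: "(\<lambda>\<omega>. (k a b (X \<omega>))\<^sup>2) = (\<lambda>\<omega>. (a\<^sup>2 * d1\<^sup>2) * (w (X \<omega>))\<^sup>2 + (2 * a * b * d1 * d2) * (w (X \<omega>) * g (X \<omega>))
        + (b\<^sup>2 * d2\<^sup>2) * (g (X \<omega>))\<^sup>2)"
      by (simp add: fun_eq_iff k_def power2_eq_square algebra_simps)
    show "integrable M (\<lambda>\<omega>. (k a b (X \<omega>))\<^sup>2)"
      unfolding eq using w_var(1) wg(1) g_sq by simp
    have "expectation (\<lambda>\<omega>. (k a b (X \<omega>))\<^sup>2) = (a\<^sup>2 * d1\<^sup>2) * (p * (1 - p) / fq\<^sup>2) + (2 * a * b * d1 * d2) * (T / fq)
        + (b\<^sup>2 * d2\<^sup>2) * V"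
      unfolding eq using w_var wg g_sq g_var by simp
    then show "expectation (\<lambda>\<omega>. (k a b (X \<omega>))\<^sup>2) = a\<^sup>2 * s11 + 2 * a * b * s12 + b\<^sup>2 * s22"
      by (simp add: s11_def s12_def s22_def ac_simps)
  qed
  \<comment> \<open>The quadratic form of the proposed covariance matrix is the second moment of
    \<open>k a b\<close>, hence nonnegative.\<close>
  have qf: "0 \<le> a\<^sup>2 * s11 + 2 * a * b * s12 + b\<^sup>2 * s22" for a b
    unfolding k_var(2)[symmetric] by simp
  have "\<exists>N. bivariate_normal N s11 s12 s22"
    using qf[of 1 0] qf[of 0 1] quadratic_form_nonneg_imp_det[OF qf] by (intro bivariate_normal_exists) auto
  then obtain N where N: "bivariate_normal N s11 s12 s22" ..
  have sN: "sets N = sets borel" and pN: "prob_space N" using N by (auto simp: bivariate_normal_def)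

  \<comment> \<open>Linearisation of both statistics and joint convergence\<close>
  define Y1 where "Y1 n \<omega> = sqrt (real n) * (h1 (sample_quantile Xs n p \<omega>) - h1 q)" for n \<omega>
  define Y2 where "Y2 n \<omega> = sqrt (real n) * (h2 (sample_abs_central_moment Xs n r \<omega>) - h2 m)" for n \<omega>
  have [measurable]: "Y1 n \<in> borel_measurable M" "Y2 n \<in> borel_measurable M" for n
    unfolding Y1_def Y2_def by measurable
  have sm1: "small_in_prob M (\<lambda>n \<omega>. Y1 n \<omega> - d1 * normed_sum w n \<omega>)"
  proof -
    have "small_in_prob M (\<lambda>n \<omega>. Y1 n \<omega> - d1 * (sqrt (real n) * (sample_quantile Xs n p \<omega> - q)))"
      unfolding Y1_def by (rule delta_method[OF sq_m h_m(1) rep_q(2)]) (use assms(16) in \<open>simp add: q_def\<close>)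
    from small_in_prob_add[OF this small_in_prob_cmult[OF rep_q(1), of d1]]
    show ?thesis by (simp add: algebra_simps)
  qed
  have sm2: "small_in_prob M (\<lambda>n \<omega>. Y2 n \<omega> - d2 * normed_sum g n \<omega>)"
  proof -
    have "small_in_prob M (\<lambda>n \<omega>. Y2 n \<omega> - d2 * (sqrt (real n) * (sample_abs_central_moment Xs n r \<omega> - m)))"
      unfolding Y2_def by (rule delta_method[OF sample_abs_central_moment_measurable h_m(2) rep_m(4)])
        (unfold m_def, fact assms(17))
    from small_in_prob_add[OF this small_in_prob_cmult[OF rep_m(3), of d2]]
    show ?thesis by (simp add: algebra_simps)
  qed
  have conv: "conv_distr2 M (\<lambda>n \<omega>. (Y1 n \<omega>, Y2 n \<omega>)) N"
  proof (rule conv_distr2_of_cos_tendsto[OF prob_space_axioms pN sN])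
    show "(\<lambda>\<omega>. (Y1 n \<omega>, Y2 n \<omega>)) \<in> borel_measurable M" for n by measurable
    fix a b t :: real
    \<comment> \<open>All linearisation errors are collected here, so that what remains is the
      normed sum of the single function \<open>k a b\<close>.\<close>
    define R where "R n \<omega> = a * (Y1 n \<omega> - d1 * normed_sum w n \<omega>) + b * (Y2 n \<omega> - d2 * normed_sum g n \<omega>)" for n \<omega>
    have R: "small_in_prob M R" unfolding R_def by (intro small_in_prob_add small_in_prob_cmult sm1 sm2)
    have eq: "a * Y1 n \<omega> + b * Y2 n \<omega> = normed_sum (k a b) n \<omega> + R n \<omega>" for n \<omega>
    proof -
      have "normed_sum (k a b) n \<omega> = a * d1 * normed_sum w n \<omega> + b * d2 * normed_sum g n \<omega>"
        by (simp add: normed_sum_def k_def sum.distrib sum_distrib_left[symmetric] add_divide_distrib)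
      then show ?thesis by (simp add: R_def algebra_simps)
    qed
    have "(\<lambda>n. expectation (\<lambda>\<omega>. cos (normed_sum (k a b) n \<omega> + R n \<omega> + t))) \<longlonglongrightarrow>
      (\<integral>x. cos (x + t) \<partial>centered_normal (a\<^sup>2 * s11 + 2 * a * b * s12 + b\<^sup>2 * s22))"
      using normed_sum_cos_tendsto[OF k_m k_var(1) k_mean, of a b t] unfolding k_var(2)
      by (intro cos_tendsto_add_small[OF _ R]) simp_all
    moreover have "(\<integral>x. cos (x + t) \<partial>centered_normal (a\<^sup>2 * s11 + 2 * a * b * s12 + b\<^sup>2 * s22)) =
      (\<integral>z. cos (a * fst z + b * snd z + t) \<partial>N)"
    proof -
      have "centered_normal (a\<^sup>2 * s11 + 2 * a * b * s12 + b\<^sup>2 * s22) = distr N borel (\<lambda>z. a * fst z + b * snd z)"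
        using N by (simp add: bivariate_normal_def case_prod_unfold)
      moreover have "(\<lambda>z. a * fst z + b * snd z) \<in> borel_measurable N"
        unfolding measurable_cong_sets[OF sN refl] by (intro borel_measurable_continuous_onI continuous_intros)
      ultimately show ?thesis by (simp add: integral_distr)
    qed
    ultimately show "(\<lambda>n. expectation (\<lambda>\<omega>. cos (a * fst (Y1 n \<omega>, Y2 n \<omega>) + b * snd (Y1 n \<omega>, Y2 n \<omega>) + t)))
      \<longlonglongrightarrow> (\<integral>z. cos (a * fst z + b * snd z + t) \<partial>N)"
      by (simp add: eq)
  qed

  \<comment> \<open>Correlation of the limit law\<close>
  have corr: "correlation2 N = sgn (d1 * d2) * T / sqrt (p * (1 - p) * V)" if "d1 * d2 \<noteq> 0" "V > 0"
  proof -
    have "sqrt (s11 * s22) = sqrt ((d1 * d2 / fq)\<^sup>2 * (p * (1 - p) * V))"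
      by (simp add: s11_def s22_def power_divide power_mult_distrib)
    \<comment> \<open>The root of the square is an absolute value; its quotient with d1 d2 in the
      numerator is the sign in the claim, while the density cancels.\<close>
    also have "\<dots> = \<bar>d1 * d2\<bar> / fq * sqrt (p * (1 - p) * V)"
      using fq by (simp only: real_sqrt_mult real_sqrt_abs) simp
    finally have "correlation2 N = (d1 * d2) * T / fq / (\<bar>d1 * d2\<bar> / fq * sqrt (p * (1 - p) * V))"
      using correlation2_bivariate_normal[OF N] by (simp add: s12_def)
    also have "\<dots> = (d1 * d2 / \<bar>d1 * d2\<bar>) * T / sqrt (p * (1 - p) * V)"
      using fq by simp
    also have "d1 * d2 / \<bar>d1 * d2\<bar> = sgn (d1 * d2)" using that(1) by (simp only: sgn_if abs_if) simp
    finally show ?thesis .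
  qed
  have c_eq: "(\<integral>\<omega>. (X \<omega> - \<mu>) ^ (r - 1) * (sgn (X \<omega> - \<mu>)) ^ r \<partial>M) = c"
    by (simp add: c_def signed_power_def)
  have "bivariate_normal N s11 s12 s22 \<and>
      conv_distr2 M (\<lambda>n \<omega>. (sqrt (real n) * (h1 (sample_quantile Xs n p \<omega>) - h1 q),
         sqrt (real n) * (h2 (sample_abs_central_moment Xs n r \<omega>) - h2 m))) N \<and>
      (d1 * d2 \<noteq> 0 \<and> V > 0 \<longrightarrow> correlation2 N = sgn (d1 * d2) * T / sqrt (p * (1 - p) * V))"
    using N conv corr unfolding Y1_def Y2_def by blast
  then show ?thesis
    unfolding Let_def \<mu>_def[symmetric] q_def[symmetric] m_def[symmetric] c_eq
    unfolding V_def T_def s11_def s12_def s22_def Z_def by blast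
qed

end
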